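(* Let $\mathbb{F}_q$ be a finite field with $q$ elements. Then $$\liminf_{N\to\infty}\frac{E^*_N(\mathcal{S})}{\sqrt{2N}}\geq 1$$ holds $\mu_q^\infty$-almost everywhere, i.e. for a set of sequences $\mathcal{S}\in\mathbb{F}_q^\infty$ of $\mu_q^\infty$-measure $1$.
   Context: For a sequence $\mathcal{S}=(s_i)_{i=0}^\infty$ over $\mathbb{F}_q$, its generating function is the formal power series $G(x)=\sum_{i=0}^\infty s_i x^i$ over $\mathbb{F}_q$. For a positive integer $N$, the $N$th i-expansion complexity (irreducible-expansion complexity) $E_N^*(\mathcal{S})$ is defined to be $0$ if $s_0=\dots=s_{N-1}=0$, and otherwise the least total degree of an irreducible polynomial $h(x,y)\in\mathbb{F}_q[x,y]$ with $h(x,G(x))\equiv 0\bmod x^N$. $\mu_q$ is the uniform probability measure on $\mathbb{F}_q$ (assigning measure $1/q$ to each element), $\mathbb{F}_q^\infty$ is the space of all sequences $(s_i)_{i=0}^\infty$ over $\mathbb{F}_q$, and $\mu_q^\infty$ is the complete product probability measure on $\mathbb{F}_q^\infty$ induced by $\mu_q$. *)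

theory Defs
  imports
    "HOL-Probability.Probability"
    "HOL-Computational_Algebra.Polynomial_FPS"
    "HOL-Computational_Algebra.Polynomial_Factorial"
begin

text \<open>
  Bivariate polynomials \<open>h(x,y)\<close> over \<open>F\<close> are elements of \<open>F[x][y]\<close>: the outer variable
  is \<open>y\<close>, so \<open>coeff (coeff h i) j\<close> is the coefficient of \<open>x\<^sup>j y\<^sup>i\<close>.
  The inserted \<open>0\<close> only serves to make the total degree of the zero polynomial \<open>0\<close>.
\<close>

definition total_degree :: "'a::zero poly poly \<Rightarrow> nat" where
  "total_degree h = Max (insert 0 {i + j | i j. coeff (coeff h i) j \<noteq> 0})"

definition subst_y :: "'a::comm_ring_1 poly poly \<Rightarrow> 'a fps \<Rightarrow> 'a fps" where
  "subst_y h G = poly (map_poly fps_of_poly h) G"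

text \<open>
  The sequence \<open>s\<close> has generating function \<open>Abs_fps s\<close>, and divisibility by \<open>fps_X ^ N\<close> is
  congruence to \<open>0\<close> modulo \<open>x\<^sup>N\<close>. The least degree always exists, as the polynomial
  \<open>y - (s\<^sub>0 + s\<^sub>1 x + \<dots> + s\<^sub>N\<^sub>-\<^sub>1 x\<^sup>N\<^sup>-\<^sup>1)\<close> is irreducible.
\<close>

definition i_expansion_complexity :: "nat \<Rightarrow> (nat \<Rightarrow> 'a::field) \<Rightarrow> nat" where
  "i_expansion_complexity N s =
     (if \<forall>i<N. s i = 0 then 0
      else (LEAST d. \<exists>h :: 'a poly poly.
              irreducible h \<and> fps_X ^ N dvd subst_y h (Abs_fps s) \<and> total_degree h = d))"

definition sequence_measure :: "(nat \<Rightarrow> 'a::finite) measure" where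
  "sequence_measure =
     completion (\<Pi>\<^sub>M i\<in>(UNIV :: nat set). uniform_count_measure (UNIV :: 'a set))"

end

theory Submission
  imports Defs "Berlekamp_Zassenhaus.Unique_Factorization_Poly" "HOL-Real_Asymp.Real_Asymp"
begin

text \<open>
  Write \<open>q = |F|\<close>, and suppose that an irreducible \<open>h\<close> of total degree at most \<open>d\<close>, \<open>d\<^sup>2 \<le> 2 \<kappa>' N\<close>,
  satisfies \<open>h(x, G) \<equiv> 0 mod x\<^sup>N\<close>. Let \<open>t\<close> be least such that \<open>h\<close> vanishes modulo \<open>x\<^sup>N\<close> on the whole ball
  \<open>G + x\<^sup>t F[[x]]\<close> (identically, as a polynomial in the displacement), and put \<open>u = N - t\<close>. For given \<open>h\<close>
  and \<open>t\<close> there are at most \<open>d\<close> such balls, by following the multiplicities of the roots of \<open>h\<close> along the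
  tree of residues. So \<open>h\<close> accounts for at most \<open>d q\<^sup>u\<close> of the \<open>q\<^sup>N\<close> prefixes, and it remains to bound the
  number of relevant \<open>h\<close>.

  If \<open>4 u > d\<^sup>2\<close>, then \<open>h\<close> vanishes doubly along \<open>G\<close> to such an order that, by Bezout's theorem, a residue
  of \<open>G\<close> modulo a small power of \<open>x\<close> determines \<open>h\<close> up to a constant. If \<open>4 u \<le> d\<^sup>2\<close>, then \<open>h\<close> vanishes modulo
  \<open>x\<^sup>2\<^sup>u\<close> on a ball of radius \<open>x\<^sup>u\<close>. Assume it is already known that almost every \<open>G\<close> eventually admits no
  nonzero \<open>Q\<close> with \<open>(deg Q)\<^sup>2 \<le> 2 \<kappa> m\<close> and \<open>Q(x, G) \<equiv> 0 mod x\<^sup>m\<close>. For \<open>m = 2 u\<close> this makes the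
  vanishing of \<open>h\<close> cost about \<open>2 \<kappa> u\<close> independent linear conditions, so that there are about \<open>q\<^bsup>D + (2 - 2 \<kappa>) u\<^esup>\<close>
  prefixes, where \<open>D \<approx> d\<^sup>2 / 2\<close>. In both cases the proportion of bad prefixes is summable over \<open>N\<close> if
  \<open>\<kappa>' (2 - \<kappa>) < 1\<close>, and Borel-Cantelli together with a passage to irreducible factors improves \<open>\<kappa>\<close> to \<open>\<kappa>'\<close>.
  Iterating from \<open>\<kappa> = 0\<close> reaches every \<open>\<kappa> < 1\<close>.
\<close>

section \<open>Total degree and counting\<close>

text \<open>Representatives of the residues modulo x^n. A condition on coefficients, unlike a bound
  on the degree, leaves only the zero polynomial for \<open>n = 0\<close>.\<close>

definition polys_below :: "nat \<Rightarrow> 'a::zero poly set" where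
  "polys_below n = {p. \<forall>j\<ge>n. coeff p j = 0}"

text \<open>A separate bound for each power of y covers two regions at once: the triangle of bounded
  total degree and the monomials of bounded weight in the Bezout argument.\<close>

definition bipolys_below :: "(nat \<Rightarrow> nat) \<Rightarrow> 'a::zero poly poly set" where
  "bipolys_below \<beta> = {h. \<forall>i j. j \<ge> \<beta> i \<longrightarrow> coeff (coeff h i) j = 0}"

lemma polys_below_0: "polys_below 0 = {0}"
  by (auto simp: polys_below_def poly_eq_iff)

lemma polys_below_Suc:
  "polys_below (Suc n) = (\<lambda>(c, p). pCons c p) ` (UNIV \<times> polys_below n)"
proof (intro equalityI subsetI)
  fix p :: "'a poly" assume p: "p \<in> polys_below (Suc n)"
  obtain c p' where p': "p = pCons c p'" by (cases p) auto
  have "p' \<in> polys_below n"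
    unfolding polys_below_def
  proof (safe)
    fix j assume "j \<ge> n"
    then have "coeff p (Suc j) = 0" using p by (simp add: polys_below_def del: coeff_pCons_Suc)
    then show "coeff p' j = 0" using p' by simp
  qed
  then show "p \<in> (\<lambda>(c, p). pCons c p) ` (UNIV \<times> polys_below n)" using p' by auto
next
  fix p assume "p \<in> (\<lambda>(c, p). pCons c p) ` (UNIV \<times> (polys_below n :: 'a poly set))"
  then show "p \<in> polys_below (Suc n)"
    by (auto simp: polys_below_def coeff_pCons split: nat.splits)
qed

lemma finite_polys_below: "finite (polys_below n :: 'a::{finite,zero} poly set)"
  by (induction n) (simp_all add: polys_below_0 polys_below_Suc)

lemma card_polys_below: "card (polys_below n :: 'a::{finite,zero} poly set) = CARD('a) ^ n"
proof (induction n)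
  case (Suc n)
  have "inj_on (\<lambda>(c, p). pCons c p) (UNIV \<times> (polys_below n :: 'a poly set))"
    by (auto simp: inj_on_def)
  then show ?case by (simp add: polys_below_Suc card_image card_cartesian_product Suc)
qed (simp add: polys_below_0)

lemma bipolys_below_Suc:
  "bipolys_below \<beta> = (\<lambda>(c, p). pCons c p) ` (polys_below (\<beta> 0) \<times> bipolys_below (\<beta> \<circ> Suc))"
proof (intro equalityI subsetI)
  fix p :: "'a poly poly" assume p: "p \<in> bipolys_below \<beta>"
  obtain c p' where p': "p = pCons c p'" by (cases p) auto
  have "p' \<in> bipolys_below (\<beta> \<circ> Suc)"
    unfolding bipolys_below_def
  proof (safe)
    fix i j assume "j \<ge> (\<beta> \<circ> Suc) i"
    then have "coeff (coeff p (Suc i)) j = 0"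
      using p by (simp add: bipolys_below_def del: coeff_pCons_Suc)
    then show "coeff (coeff p' i) j = 0" using p' by simp
  qed
  moreover have "c \<in> polys_below (\<beta> 0)"
    unfolding polys_below_def
  proof (safe)
    fix j assume "j \<ge> \<beta> 0"
    then have "coeff (coeff p 0) j = 0" using p by (simp add: bipolys_below_def del: coeff_pCons_0)
    then show "coeff c j = 0" using p' by simp
  qed
  ultimately show "p \<in> (\<lambda>(c, p). pCons c p) ` (polys_below (\<beta> 0) \<times> bipolys_below (\<beta> \<circ> Suc))"
    using p' by auto
next
  fix p :: "'a poly poly"
  assume "p \<in> (\<lambda>(c, p). pCons c p) ` (polys_below (\<beta> 0) \<times> bipolys_below (\<beta> \<circ> Suc))"
  then show "p \<in> bipolys_below \<beta>"
    by (auto simp: polys_below_def bipolys_below_def coeff_pCons split: nat.splits)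
qed

lemma card_bipolys_below_aux:
  assumes "\<And>i. i \<ge> K \<Longrightarrow> \<beta> i = 0"
  shows "finite (bipolys_below \<beta> :: 'a::{finite,zero} poly poly set) \<and>
     card (bipolys_below \<beta> :: 'a poly poly set) = CARD('a) ^ (\<Sum>i<K. \<beta> i)"
  using assms
proof (induction K arbitrary: \<beta>)
  case 0
  then have "bipolys_below \<beta> = {0 :: 'a poly poly}"
    by (auto simp: bipolys_below_def poly_eq_iff)
  then show ?case by simp
next
  case (Suc K)
  have IH: "finite (bipolys_below (\<beta> \<circ> Suc) :: 'a poly poly set)"
    "card (bipolys_below (\<beta> \<circ> Suc) :: 'a poly poly set) = CARD('a) ^ (\<Sum>i<K. (\<beta> \<circ> Suc) i)"
    using Suc.IH[of "\<beta> \<circ> Suc"] Suc.prems by (simp_all add: comp_def)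
  have inj: "inj_on (\<lambda>(c, p). pCons c p) (polys_below (\<beta> 0) \<times> (bipolys_below (\<beta> \<circ> Suc) :: 'a poly poly set))"
    by (auto simp: inj_on_def)
  have "(\<Sum>i<Suc K. \<beta> i) = \<beta> 0 + (\<Sum>i<K. (\<beta> \<circ> Suc) i)"
    by (simp add: sum.lessThan_Suc_shift del: sum.lessThan_Suc)
  then show ?case
    by (subst (1 2) bipolys_below_Suc)
      (simp add: card_image[OF inj] card_cartesian_product IH finite_polys_below card_polys_below power_add)
qed

lemmas finite_bipolys_below = card_bipolys_below_aux[THEN conjunct1]
  and card_bipolys_below = card_bipolys_below_aux[THEN conjunct2]

lemma bipolys_below_add:
  "f \<in> bipolys_below \<beta> \<Longrightarrow> g \<in> bipolys_below \<beta> \<Longrightarrow> f + g \<in> bipolys_below \<beta>"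
  for f g :: "'a::comm_ring_1 poly poly"
  by (simp add: bipolys_below_def)

lemma bipolys_below_diff:
  "f \<in> bipolys_below \<beta> \<Longrightarrow> g \<in> bipolys_below \<beta> \<Longrightarrow> f - g \<in> bipolys_below \<beta>"
  for f g :: "'a::comm_ring_1 poly poly"
  by (simp add: bipolys_below_def)

definition bideg :: "nat \<Rightarrow> 'a::zero poly poly set" where
  "bideg n = bipolys_below (\<lambda>i. Suc n - i)"

lemma bideg_iff: "h \<in> bideg n \<longleftrightarrow> (\<forall>i j. coeff (coeff h i) j \<noteq> 0 \<longrightarrow> i + j \<le> n)"
  unfolding bideg_def bipolys_below_def mem_Collect_eq
proof (intro iff_allI)
  fix i j show "(Suc n - i \<le> j \<longrightarrow> coeff (coeff h i) j = 0) \<longleftrightarrow> (coeff (coeff h i) j \<noteq> 0 \<longrightarrow> i + j \<le> n)"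
    by (cases "i + j \<le> n") auto
qed

lemma finite_total_degrees: "finite {i + j | i j. coeff (coeff h i) j \<noteq> (0::'a::zero)}"
proof -
  have "{i + j | i j. coeff (coeff h i) j \<noteq> 0} \<subseteq>
      (\<lambda>(i, j). i + j) ` (SIGMA i:{..degree h}. {..degree (coeff h i)})"
  proof safe
    fix i j assume nz: "coeff (coeff h i) j \<noteq> 0"
    then have "coeff h i \<noteq> 0" by auto
    then have "i \<le> degree h" by (rule le_degree)
    moreover have "j \<le> degree (coeff h i)" using nz by (rule le_degree)
    ultimately show "i + j \<in> (\<lambda>(i, j). i + j) ` (SIGMA i:{..degree h}. {..degree (coeff h i)})"
      by force
  qed
  then show ?thesis by (rule finite_subset) auto
qed

lemma total_degree_le_iff: "total_degree h \<le> n \<longleftrightarrow> h \<in> bideg n"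
  unfolding total_degree_def bideg_iff using finite_total_degrees[of h] by (subst Max_le_iff) auto

lemma total_degree_attained:
  assumes "h \<noteq> 0"
  obtains i j where "coeff (coeff h i) j \<noteq> 0" "i + j = total_degree h"
proof -
  have "total_degree h \<in> insert 0 {i + j | i j. coeff (coeff h i) j \<noteq> 0}"
    unfolding total_degree_def using finite_total_degrees[of h] by (intro Max_in) auto
  moreover have "\<exists>i j. coeff (coeff h i) j \<noteq> 0 \<and> i + j = total_degree h" if "total_degree h = 0"
  proof -
    obtain i where i: "coeff h i \<noteq> 0" using assms by (auto simp: poly_eq_iff)
    then obtain j where j: "coeff (coeff h i) j \<noteq> 0" by (auto simp: poly_eq_iff)
    have "i + j \<le> total_degree h"
      using total_degree_le_iff[of h "total_degree h"] j by (auto simp: bideg_iff)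
    with j that show ?thesis by (intro exI[of _ i] exI[of _ j]) auto
  qed
  ultimately show thesis using that by auto
qed

lemma degree_le_total_degree: "degree h \<le> total_degree h"
proof (cases "h = 0")
  case False
  then have "coeff h (degree h) \<noteq> 0" by simp
  then obtain j where j: "coeff (coeff h (degree h)) j \<noteq> 0" by (auto simp: poly_eq_iff)
  then have "degree h + j \<le> total_degree h"
    using total_degree_le_iff[of h "total_degree h"] by (auto simp: bideg_iff)
  then show ?thesis by simp
qed simp

lemma bideg_mult:
  fixes f g :: "'a::comm_ring_1 poly poly"
  assumes "f \<in> bideg m" "g \<in> bideg n"
  shows "f * g \<in> bideg (m + n)"
  unfolding bideg_iff
proof (intro allI impI)
  fix i j assume "coeff (coeff (f * g) i) j \<noteq> 0"
  then have "(\<Sum>k\<le>i. \<Sum>l\<le>j. coeff (coeff f k) l * coeff (coeff g (i - k)) (j - l)) \<noteq> 0"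
    by (simp add: coeff_mult coeff_sum)
  then obtain k where k: "k \<le> i" and
    "(\<Sum>l\<le>j. coeff (coeff f k) l * coeff (coeff g (i - k)) (j - l)) \<noteq> 0"
    by (auto elim: sum.not_neutral_contains_not_neutral)
  then obtain l where l: "l \<le> j" and
    "coeff (coeff f k) l * coeff (coeff g (i - k)) (j - l) \<noteq> 0"
    by (auto elim: sum.not_neutral_contains_not_neutral)
  then have "coeff (coeff f k) l \<noteq> 0" "coeff (coeff g (i - k)) (j - l) \<noteq> 0" by auto
  then have "k + l \<le> m" "(i - k) + (j - l) \<le> n" using assms by (auto simp: bideg_iff)
  with k l show "i + j \<le> m + n" by linarith
qed

text \<open>Among the monomials of top total degree, those of largest \<open>y\<close>-degree do not cancel.\<close>

lemma total_degree_mult: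
  fixes f g :: "'a::idom poly poly"
  assumes "f \<noteq> 0" "g \<noteq> 0"
  shows "total_degree (f * g) = total_degree f + total_degree g"
proof (rule antisym)
  show "total_degree (f * g) \<le> total_degree f + total_degree g"
    using bideg_mult total_degree_le_iff by blast
next
  have top: "\<exists>k. k \<le> total_degree h \<and> coeff (coeff h k) (total_degree h - k) \<noteq> 0 \<and>
     (\<forall>i>k. i \<le> total_degree h \<longrightarrow> coeff (coeff h i) (total_degree h - i) = 0)"
    if nz: "h \<noteq> 0" for h :: "'a poly poly"
  proof -
    let ?P = "\<lambda>i. i \<le> total_degree h \<and> coeff (coeff h i) (total_degree h - i) \<noteq> 0"
    obtain i j where "coeff (coeff h i) j \<noteq> 0" "i + j = total_degree h"
      by (rule total_degree_attained[OF nz])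
    then have "?P i" by (metis add_diff_cancel_left' le_add1)
    define S where "S = {i. ?P i}"
    have S: "finite S" "S \<noteq> {}" using \<open>?P i\<close> by (auto simp: S_def)
    have "Max S \<in> S" using S by (rule Max_in)
    moreover have "i' \<notin> S" if "i' > Max S" for i' using Max_ge[OF S(1), of i'] that by auto
    ultimately show ?thesis unfolding S_def by blast
  qed
  obtain k where k: "k \<le> total_degree f" "coeff (coeff f k) (total_degree f - k) \<noteq> 0"
    "\<And>i. i > k \<Longrightarrow> i \<le> total_degree f \<Longrightarrow> coeff (coeff f i) (total_degree f - i) = 0"
    using top[OF assms(1)] by blast
  obtain l where l: "l \<le> total_degree g" "coeff (coeff g l) (total_degree g - l) \<noteq> 0"
    "\<And>i. i > l \<Longrightarrow> i \<le> total_degree g \<Longrightarrow> coeff (coeff g i) (total_degree g - i) = 0"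
    using top[OF assms(2)] by blast
  define a b where "a = total_degree f - k" and "b = total_degree g - l"
  let ?c = "\<lambda>i j. coeff (coeff f i) j * coeff (coeff g (k + l - i)) (a + b - j)"
  have vanish: "?c i j = 0" if "i \<le> k + l" "j \<le> a + b" "(i, j) \<noteq> (k, a)" for i j
  proof (rule ccontr)
    assume "?c i j \<noteq> 0"
    then have nz: "coeff (coeff f i) j \<noteq> 0" "coeff (coeff g (k + l - i)) (a + b - j) \<noteq> 0" by auto
    have "f \<in> bideg (total_degree f)" "g \<in> bideg (total_degree g)"
      by (simp_all flip: total_degree_le_iff)
    then have le: "i + j \<le> total_degree f" "(k + l - i) + (a + b - j) \<le> total_degree g"
      using nz by (auto simp: bideg_iff)
    then have eq: "i + j = total_degree f" "(k + l - i) + (a + b - j) = total_degree g"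
      using k(1) l(1) that(1,2) by (auto simp: a_def b_def)
    then have j: "j = total_degree f - i" "a + b - j = total_degree g - (k + l - i)" by auto
    have "i \<le> total_degree f" "k + l - i \<le> total_degree g" using eq by linarith+
    then have "i \<le> k" using k(3)[of i] nz(1) unfolding j(1) by (meson not_le)
    moreover have "k + l - i \<le> l"
      using l(3)[of "k + l - i"] nz(2) \<open>k + l - i \<le> total_degree g\<close> unfolding j(2) by (meson not_le)
    ultimately have "i = k" using that(1) by linarith
    then show False using that(3) j by (simp add: a_def)
  qed
  have "coeff (coeff (f * g) (k + l)) (a + b) = (\<Sum>i\<le>k+l. \<Sum>j\<le>a+b. ?c i j)"
    by (simp add: coeff_mult coeff_sum)
  also have "\<dots> = (\<Sum>(i,j)\<in>{..k+l}\<times>{..a+b}. ?c i j)" by (simp add: sum.cartesian_product)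
  also have "\<dots> = (\<Sum>(i,j)\<in>{(k,a)}. ?c i j)"
  proof (rule sum.mono_neutral_right)
    show "{(k, a)} \<subseteq> {..k+l}\<times>{..a+b}" by simp
    show "\<forall>x\<in>{..k+l}\<times>{..a+b} - {(k, a)}. (case x of (i, j) \<Rightarrow> ?c i j) = 0"
      using vanish by fast
  qed simp
  also have "\<dots> \<noteq> 0" using k(2) l(2) by (simp add: a_def b_def)
  finally have "coeff (coeff (f * g) (k + l)) (a + b) \<noteq> 0" .
  then have "(k + l) + (a + b) \<le> total_degree (f * g)"
    using total_degree_le_iff[of "f * g" "total_degree (f * g)"] by (auto simp: bideg_iff)
  then show "total_degree f + total_degree g \<le> total_degree (f * g)"
    using k(1) l(1) by (simp add: a_def b_def)
qed

lemma finite_bideg: "finite (bideg n :: 'a::{finite,zero} poly poly set)"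
  unfolding bideg_def by (rule finite_bipolys_below[of "Suc n"]) auto

lemma sum_Suc_diff: "(\<Sum>i<Suc n. Suc n - i) = Suc n * (n + 2) div 2"
proof (induction n)
  case (Suc n)
  have "(\<Sum>i<Suc (Suc n). Suc (Suc n) - i) = Suc (Suc n) + (\<Sum>i<Suc n. Suc n - i)"
    by (subst sum.lessThan_Suc_shift) simp
  also have "\<dots> = (2 * Suc (Suc n) + Suc n * (n + 2)) div 2" unfolding Suc by simp
  also have "2 * Suc (Suc n) + Suc n * (n + 2) = Suc (Suc n) * (Suc n + 2)" by (simp add: algebra_simps)
  finally show ?case .
qed simp

lemma card_bideg: "card (bideg n :: 'a::{finite,zero} poly poly set) = CARD('a) ^ (Suc n * (n + 2) div 2)"
proof -
  have "card (bideg n :: 'a poly poly set) = CARD('a) ^ (\<Sum>i<Suc n. Suc n - i)"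
    unfolding bideg_def by (rule card_bipolys_below) simp
  then show ?thesis unfolding sum_Suc_diff .
qed

section \<open>Weighted ideals and minimal balls\<close>

lemma monom_1_dvd_monom_mult_iff:
  "monom 1 n dvd monom 1 m * p \<longleftrightarrow> monom 1 (n - m) dvd (p :: 'a::idom poly)"
proof (cases "n \<le> m")
  case True
  then have "monom 1 n dvd (monom 1 m :: 'a poly)" by (simp add: monom_1_dvd_iff')
  then have "monom 1 n dvd monom 1 m * p" by (rule dvd_mult2)
  with True show ?thesis by (simp add: monom_eq_1 const_poly_dvd_iff)
next
  case False
  then have "(monom 1 n :: 'a poly) = monom 1 m * monom 1 (n - m)" by (simp add: mult_monom)
  then show ?thesis by (simp add: monom_eq_0_iff)
qed

text \<open>
  The polynomials \<open>h\<close> with \<open>x\<^sup>n\<close> dividing \<open>h(x, g + x\<^sup>t z)\<close> in \<open>F[x][z]\<close>. Equivalently, \<open>h\<close> lies in the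
  ideal of elements of weight at least \<open>n\<close>, where \<open>x\<close> has weight \<open>1\<close> and \<open>y - g\<close> has weight \<open>t\<close>.
\<close>

definition weight_ideal :: "nat \<Rightarrow> nat \<Rightarrow> 'a::idom poly \<Rightarrow> 'a poly poly set" where
  "weight_ideal t n g = {h. [:monom 1 n:] dvd pcompose h [:g, monom 1 t:]}"

text \<open>Substituting x^t z for y - g multiplies the coefficient of (y - g)^k by x^(t k).\<close>

lemma coeff_pcompose_shift:
  "coeff (pcompose h [:g, monom 1 t:]) k = monom 1 (t * k) * coeff (pcompose h [:g, 1:]) k"
  for g :: "'a::idom poly"
proof -
  have "[:g, monom 1 t:] = pcompose [:g, 1:] [:0, monom 1 t:]" by (simp add: pcompose_pCons)
  then have "pcompose h [:g, monom 1 t:] = pcompose (pcompose h [:g, 1:]) [:0, monom 1 t:]"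
    by (simp only: pcompose_assoc)
  then show ?thesis by (simp add: coeff_pcompose_linear monom_power)
qed

text \<open>Truncated subtraction is deliberate: once \<open>t * k \<ge> n\<close> the condition is
  void, as (y - g)^k alone has weight at least n.\<close>

lemma weight_ideal_iff:
  "h \<in> weight_ideal t n g \<longleftrightarrow> (\<forall>k. monom 1 (n - t * k) dvd coeff (pcompose h [:g, 1:]) k)"
  by (simp add: weight_ideal_def const_poly_dvd_iff coeff_pcompose_shift monom_1_dvd_monom_mult_iff)

lemma weight_ideal_diff:
  "f \<in> weight_ideal t n g \<Longrightarrow> h \<in> weight_ideal t n g \<Longrightarrow> f - h \<in> weight_ideal t n g"
  by (simp add: weight_ideal_def pcompose_diff dvd_diff)

lemma weight_ideal_add:
  "f \<in> weight_ideal t n g \<Longrightarrow> h \<in> weight_ideal t n g \<Longrightarrow> f + h \<in> weight_ideal t n g"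
  by (simp add: weight_ideal_def pcompose_add dvd_add)

lemma weight_ideal_mult:
  assumes "f \<in> weight_ideal t m g" "h \<in> weight_ideal t n g"
  shows "f * h \<in> weight_ideal t (m + n) g"
proof -
  have "([:monom 1 m:] * [:monom 1 n:] :: 'a poly poly) = [:monom 1 (m + n):]"
    by (simp add: mult_monom add.commute)
  then show ?thesis
    using mult_dvd_mono assms unfolding weight_ideal_def mem_Collect_eq pcompose_mult by metis
qed

lemma weight_ideal_mult_right:
  "f \<in> weight_ideal t n g \<Longrightarrow> f * h \<in> weight_ideal t n g"
  by (simp add: weight_ideal_def pcompose_mult)

text \<open>A smaller ball inside a larger one inherits the vanishing: \<open>g' + x^t' z\<close>
  arises from \<open>g + x^t z\<close> on replacing z by \<open>w + x^(t' - t) z\<close>.\<close>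

lemma weight_ideal_shift:
  assumes "h \<in> weight_ideal t n g" "t \<le> t'" "monom 1 t dvd g' - g"
  shows "h \<in> weight_ideal t' n g'"
proof -
  obtain w where w: "g' - g = monom 1 t * w" using assms(3) by blast
  have "[:g', monom 1 t':] = pcompose [:g, monom 1 t:] [:w, monom 1 (t' - t):]"
    using w assms(2) by (simp add: pcompose_pCons mult_monom algebra_simps)
  then have "pcompose h [:g', monom 1 t':] = pcompose (pcompose h [:g, monom 1 t:]) [:w, monom 1 (t' - t):]"
    by (simp only: pcompose_assoc)
  moreover obtain k where "pcompose h [:g, monom 1 t:] = [:monom 1 n:] * k"
    using assms(1) by (auto simp: weight_ideal_def)
  ultimately have "pcompose h [:g', monom 1 t':] = [:monom 1 n:] * pcompose k [:w, monom 1 (t' - t):]"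
    by (simp only: pcompose_mult pcompose_const)
  then show ?thesis unfolding weight_ideal_def mem_Collect_eq by (metis dvd_triv_left)
qed

lemma weight_ideal_cong:
  assumes "monom 1 t dvd g' - g"
  shows "weight_ideal t n g = weight_ideal t n g'"
proof -
  have "monom 1 t dvd g - g'" using assms by (subst minus_diff_eq[symmetric]) (simp only: dvd_minus_iff)
  then show ?thesis using assms weight_ideal_shift by blast
qed

text \<open>Passing to a coarser scale \<open>\<sigma> \<le> t\<close> costs at most the factor \<open>\<sigma>/t\<close> in the weight, rounded up.\<close>

lemma weight_ideal_rescale:
  assumes h: "h \<in> weight_ideal t n g" and st: "\<sigma> \<le> t" and m: "m * t < n * \<sigma> + t"
  shows "h \<in> weight_ideal \<sigma> m g"
  unfolding weight_ideal_iff
proof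
  fix k
  have le: "m - \<sigma> * k \<le> n - t * k"
  proof (cases "m \<le> \<sigma> * k")
    case False
    define a where "a = m - \<sigma> * k"
    have a: "m = \<sigma> * k + a" "a \<ge> 1" using False by (auto simp: a_def)
    then have 1: "\<sigma> * (t * k) + a * t < n * \<sigma> + t" using m by (simp add: algebra_simps)
    have "t * k \<le> n"
    proof (rule ccontr)
      assume "\<not> t * k \<le> n"
      then have "n * \<sigma> \<le> \<sigma> * (t * k)" by (simp add: mult.commute)
      moreover have "t \<le> a * t" using a(2) by simp
      ultimately show False using 1 by linarith
    qed
    then obtain b where b: "n = t * k + b" using le_Suc_ex by blast
    have "a * t < b * \<sigma> + t" using 1 by (simp add: b algebra_simps)
    also have "\<dots> \<le> b * t + t" using st by (simp add: mult_le_mono)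
    finally have "a * t < (b + 1) * t" by simp
    then have "a < b + 1" by (rule mult_less_cancel2[THEN iffD1, THEN conjunct2])
    then have "a \<le> b" by simp
    then show ?thesis by (simp add: a_def b)
  qed simp
  then have "monom 1 (m - \<sigma> * k) dvd (monom 1 (n - t * k) :: 'a poly)"
    by (simp add: monom_1_dvd_iff')
  then show "monom 1 (m - \<sigma> * k) dvd coeff (pcompose h [:g, 1:]) k"
    using h unfolding weight_ideal_iff by (meson dvd_trans)
qed

text \<open>In weight \<open>2 u\<close>, \<open>u = n - t\<close>, only the coefficients of \<open>1\<close> and \<open>y - g\<close> matter.\<close>

lemma weight_ideal_double:
  assumes h: "h \<in> weight_ideal t n g" and t: "2 * (n - t) \<le> n"
  shows "h \<in> weight_ideal (n - t) (2 * (n - t)) g"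
  unfolding weight_ideal_iff
proof
  fix k
  have "2 * (n - t) - (n - t) * k \<le> n - t * k"
  proof -
    consider "k = 0" | "k = 1" | "k \<ge> 2" by linarith
    then show ?thesis
    proof cases
      case 3
      then have "2 * (n - t) \<le> (n - t) * k" by (simp add: mult.commute)
      then show ?thesis by simp
    qed (use t in auto)
  qed
  then have "monom 1 (2 * (n - t) - (n - t) * k) dvd (monom 1 (n - t * k) :: 'a poly)"
    by (simp add: monom_1_dvd_iff')
  then show "monom 1 (2 * (n - t) - (n - t) * k) dvd coeff (pcompose h [:g, 1:]) k"
    using h unfolding weight_ideal_iff by (meson dvd_trans)
qed

text \<open>At scale n only the condition for k = 0 survives, and that coefficient of the expansion
  in y - g is h(x, g).\<close>

lemma weight_ideal_full_scale_iff:
  "h \<in> weight_ideal n n g \<longleftrightarrow> monom 1 n dvd poly h g"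
proof -
  have c0: "coeff (pcompose h [:g, 1:]) 0 = poly h g"
    by (metis pcompose_coeff_0 coeff_pCons_0 poly_0_coeff_0 poly_pcompose poly_pCons mult_zero_left add_0_right)
  show ?thesis unfolding weight_ideal_iff
  proof
    assume "monom 1 n dvd poly h g"
    then show "\<forall>k. monom 1 (n - n * k) dvd coeff (pcompose h [:g, 1:]) k"
    proof (intro allI)
      fix k assume "monom 1 n dvd poly h g"
      show "monom 1 (n - n * k) dvd coeff (pcompose h [:g, 1:]) k"
      proof (cases k)
        case (Suc k') then show ?thesis by (simp add: monom_eq_1 const_poly_dvd_iff)
      qed (simp add: c0 \<open>monom 1 n dvd poly h g\<close>)
    qed
  qed (use c0 in \<open>metis diff_zero mult_zero_right\<close>)
qed

text \<open>The shift by g preserves the leading coefficient in y. With e the y-degree, x^(n - t e)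
  divides it, while its own degree is at most d - e. As d < n, neither e nor t can be 0.\<close>

lemma weight_ideal_degree_bound:
  assumes h: "h \<in> weight_ideal t n g" and nz: "h \<noteq> 0" and d: "total_degree h \<le> d" "d < n"
  shows "n \<le> t * d" "degree h > 0"
proof -
  define e where "e = degree h"
  have deg: "degree (pcompose h [:g, 1:]) = e" by (simp add: degree_pcompose e_def)
  have "lead_coeff (pcompose h [:g, 1:]) = lead_coeff h"
    by (subst lead_coeff_comp) auto
  then have lc: "coeff (pcompose h [:g, 1:]) e = lead_coeff h" using deg by simp
  have "monom 1 (n - t * e) dvd lead_coeff h"
    using h lc unfolding weight_ideal_iff by metis
  moreover have "lead_coeff h \<noteq> 0" using nz by simp
  ultimately have 1: "n - t * e \<le> degree (lead_coeff h)"
    using dvd_imp_degree_le degree_monom_eq by (metis one_neq_zero)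
  have 2: "e + degree (lead_coeff h) \<le> d"
    using d(1) nz unfolding total_degree_le_iff bideg_iff e_def by simp
  have e: "e > 0" "t > 0" using 1 2 d by (auto intro!: Nat.gr0I)
  then show "degree h > 0" by (simp add: e_def)
  define f where "f = d - e"
  have f: "d = e + f" "degree (lead_coeff h) \<le> f" using 2 by (auto simp: f_def)
  have "f \<le> t * f" using e by simp
  moreover have "t * d = t * e + t * f" by (simp add: f algebra_simps)
  ultimately show "n \<le> t * d" using 1 f(2) by linarith
qed

section \<open>Reduction modulo x and its branches\<close>

definition reduce_x :: "'a::comm_ring_1 poly poly \<Rightarrow> 'a poly" where
  "reduce_x h = map_poly (\<lambda>p. coeff p 0) h"

lemma coeff_reduce_x: "coeff (reduce_x h) i = coeff (coeff h i) 0"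
  by (simp add: reduce_x_def coeff_map_poly)

lemma reduce_x_add: "reduce_x (f + g) = reduce_x f + reduce_x g"
  by (simp add: poly_eq_iff coeff_reduce_x)

lemma reduce_x_mult: "reduce_x (f * g) = reduce_x f * reduce_x g"
  by (simp add: poly_eq_iff coeff_reduce_x coeff_mult coeff_sum)

lemma reduce_x_pCons: "reduce_x (pCons a p) = pCons (coeff a 0) (reduce_x p)"
  by (auto simp: poly_eq_iff coeff_reduce_x coeff_pCons split: nat.splits)

lemma reduce_x_0 [simp]: "reduce_x 0 = 0"
  by (simp add: poly_eq_iff coeff_reduce_x)

lemma reduce_x_pcompose: "reduce_x (pcompose f g) = pcompose (reduce_x f) (reduce_x g)"
  by (induction f) (simp_all add: pcompose_pCons reduce_x_add reduce_x_mult reduce_x_pCons)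

lemma reduce_x_eq_0_iff: "reduce_x h = 0 \<longleftrightarrow> [:monom 1 1:] dvd h" for h :: "'a::idom poly poly"
  unfolding const_poly_dvd_iff monom_1_dvd_iff' less_one
  by (simp add: poly_eq_iff[of "reduce_x h"] coeff_reduce_x del: One_nat_def)

lemma reduce_x_1 [simp]: "reduce_x 1 = 1"
  by (simp add: poly_eq_iff coeff_reduce_x)

lemma degree_reduce_x_le: "degree (reduce_x h) \<le> degree h"
  by (rule degree_le) (auto simp: coeff_reduce_x coeff_eq_0)

text \<open>Each division by x lowers the total degree, so the process stops.\<close>

lemma split_off_x_power:
  fixes h :: "'a::idom poly poly"
  assumes "h \<noteq> 0"
  obtains m h' where "h = [:monom 1 m:] * h'" "reduce_x h' \<noteq> 0"
proof -
  have "\<exists>m h'. h = [:monom 1 m:] * h' \<and> reduce_x h' \<noteq> 0"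
    using assms
  proof (induction "total_degree h" arbitrary: h rule: less_induct)
    case less
    show ?case
    proof (cases "reduce_x h = 0")
      case False
      then show ?thesis by (intro exI[of _ 0] exI[of _ h]) (simp add: monom_eq_1 const_poly_dvd_iff)
    next
      case True
      then obtain k where k: "h = [:monom 1 1:] * k" unfolding reduce_x_eq_0_iff by blast
      have "k \<noteq> 0" using k less.prems by auto
      have X: "([:monom 1 1:] :: 'a poly poly) \<noteq> 0" by (simp add: monom_eq_0_iff)
      have "coeff (coeff ([:monom 1 1:] :: 'a poly poly) 0) 1 \<noteq> 0" by simp
      then have "0 + 1 \<le> total_degree ([:monom 1 1:] :: 'a poly poly)"
        using total_degree_le_iff[of "[:monom 1 1:] :: 'a poly poly" "total_degree ([:monom 1 1:] :: 'a poly poly)"]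
        unfolding bideg_iff by blast
      then have "total_degree k < total_degree h"
        using total_degree_mult[OF X \<open>k \<noteq> 0\<close>] k by simp
      from less.hyps[OF this \<open>k \<noteq> 0\<close>] obtain m h' where
        m: "k = [:monom 1 m:] * h'" "reduce_x h' \<noteq> 0" by blast
      have "h = [:monom 1 (Suc m):] * h'" unfolding k m
        by (simp only: mult.assoc[symmetric]) (simp add: mult_monom)
      with m(2) show ?thesis by blast
    qed
  qed
  then show thesis using that by blast
qed

text \<open>An element \<open>g\<close> stands for the ball \<open>g + x\<^sup>r F[[x]]\<close>; minimality refers to the exponent \<open>r\<close>.\<close>

definition minimal_balls :: "nat \<Rightarrow> nat \<Rightarrow> 'a::idom poly poly \<Rightarrow> 'a poly set" where
  "minimal_balls n r h =
     {g \<in> polys_below r. h \<in> weight_ideal r n g \<and> (\<forall>r'<r. h \<notin> weight_ideal r' n g)}"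

lemma finite_minimal_balls: "finite (minimal_balls n r h :: 'a::{finite,idom} poly set)"
  unfolding minimal_balls_def using finite_polys_below by (rule finite_subset[rotated]) auto

text \<open>Let \<open>B_k\<close> be the coefficients of h in powers of y - c; then
  \<open>x^k B_k = x^m h'_k\<close>. If \<mu> is the multiplicity of c as a root modulo x, then
  \<open>B_\<mu>\<close> is nonzero modulo x, which forces m \<le> \<mu>. For k > \<mu> the power
  x^(k - m) divides \<open>h'_k\<close>, so this coefficient vanishes modulo x.\<close>

lemma reduce_x_branch:
  fixes h h' :: "'a::idom poly poly"
  assumes nz: "reduce_x h \<noteq> 0" and nz': "reduce_x h' \<noteq> 0"
    and eq: "pcompose h [:[:c:], monom 1 1:] = [:monom 1 m:] * h'"
  shows "m \<le> Polynomial.order c (reduce_x h)" "degree (reduce_x h') \<le> Polynomial.order c (reduce_x h)"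
proof -
  define B where "B = pcompose h [:[:c:], 1:]"
  define \<mu> where "\<mu> = Polynomial.order c (reduce_x h)"
  have Bh': "monom 1 k * coeff B k = monom 1 m * coeff h' k" for k
    using coeff_pcompose_shift[of h "[:c:]" 1 k] eq by (simp add: B_def)
  have "reduce_x [:[:c:], 1:] = [:c, 1:]" by (simp add: reduce_x_pCons)
  then have red: "reduce_x B = pcompose (reduce_x h) [:c, 1:]"
    unfolding B_def by (simp only: reduce_x_pcompose)
  obtain s where s: "reduce_x h = [:- c, 1:] ^ \<mu> * s" "\<not> [:- c, 1:] dvd s"
    using order_decomp[OF nz] unfolding \<mu>_def by blast
  have "pcompose ([:- c, 1:] ^ \<mu>) [:c, 1:] = monom 1 \<mu>"
  proof -
    have "pcompose ([:- c, 1:] ^ \<mu>) [:c, 1:] = (pcompose [:- c, 1:] [:c, 1:]) ^ \<mu>"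
      by (induction \<mu>) (simp_all only: power_0 power_Suc pcompose_mult pcompose_1)
    also have "pcompose [:- c, 1:] [:c, 1:] = monom 1 1" by (simp add: pcompose_pCons monom_altdef)
    finally show ?thesis by (simp add: monom_power)
  qed
  then have "reduce_x B = monom 1 \<mu> * pcompose s [:c, 1:]" by (simp only: red s pcompose_mult)
  then have "coeff (coeff B \<mu>) 0 = coeff (pcompose s [:c, 1:]) 0"
    by (metis coeff_reduce_x coeff_monom_mult diff_self_eq_0 le_refl mult_1)
  also have "\<dots> = poly s c"
    by (metis poly_0_coeff_0 poly_pcompose poly_pCons mult_zero_left add_0_right)
  also have "\<dots> \<noteq> 0" using s(2) by (simp add: poly_eq_0_iff_dvd)
  finally have B\<mu>: "coeff (coeff B \<mu>) 0 \<noteq> 0" .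
  show "m \<le> \<mu>"
  proof (rule ccontr)
    assume "\<not> m \<le> \<mu>"
    then have "monom 1 (m - \<mu>) dvd coeff B \<mu>"
      using Bh'[of \<mu>] monom_1_dvd_monom_mult_iff[of m \<mu>] by (metis dvd_triv_left)
    then show False using B\<mu> \<open>\<not> m \<le> \<mu>\<close> by (simp add: monom_1_dvd_iff')
  qed
  show "degree (reduce_x h') \<le> \<mu>"
  proof (rule degree_le, intro allI impI)
    fix k assume "k > \<mu>"
    then have "m < k" using \<open>m \<le> \<mu>\<close> by simp
    then have "monom 1 (k - m) dvd coeff h' k"
      using Bh'[of k] monom_1_dvd_monom_mult_iff[of k m] by (metis dvd_triv_left)
    then show "coeff (reduce_x h') k = 0" using \<open>m < k\<close> by (simp add: monom_1_dvd_iff' coeff_reduce_x)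
  qed
qed

lemma sum_order_le_degree:
  fixes p :: "'a::{finite,idom} poly"
  assumes "p \<noteq> 0"
  shows "(\<Sum>c\<in>UNIV. Polynomial.order c p) \<le> degree p"
proof -
  have "(\<Sum>c\<in>UNIV. Polynomial.order c p) = (\<Sum>c\<in>UNIV. count (proots p) c)"
    using assms by simp
  also have "\<dots> = size (proots p)"
    unfolding size_multiset_overloaded_eq
    by (rule sum.mono_neutral_right) (auto simp: count_eq_zero_iff)
  also have "\<dots> \<le> degree p" by (rule size_proots_le)
  finally show ?thesis .
qed

text \<open>
  Substituting \<open>y = c + x z\<close> and removing the power \<open>x\<^sup>m\<close> turns the root \<open>c\<close> of \<open>h mod x\<close>, of multiplicity
  \<open>\<mu>\<close>, into a polynomial whose reduction has degree at most \<open>\<mu>\<close>, and \<open>m \<le> \<mu>\<close>.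
\<close>

lemma card_minimal_balls:
  fixes h :: "'a::{finite,idom} poly poly"
  assumes "reduce_x h \<noteq> 0" "n > 0"
  shows "card (minimal_balls n r h) \<le> degree (reduce_x h)"
  using assms
proof (induction r arbitrary: h n)
  case 0
  have "h \<notin> weight_ideal 0 n g" for g
  proof
    assume "h \<in> weight_ideal 0 n g"
    then have "h \<in> weight_ideal 0 n 0" by (rule weight_ideal_shift) (simp_all add: monom_eq_1 const_poly_dvd_iff)
    then have "[:monom 1 n:] dvd h" by (simp only: weight_ideal_def mem_Collect_eq monom_eq_1 pcompose_idR)
    then have "reduce_x h = 0" using \<open>n > 0\<close>
      by (auto simp: poly_eq_iff coeff_reduce_x const_poly_dvd_iff monom_1_dvd_iff')
    with 0 show False by simp
  qed
  then have "minimal_balls n 0 h = {}" by (simp add: minimal_balls_def)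
  then show ?case by simp
next
  case (Suc r)
  have hnz: "h \<noteq> 0" using Suc.prems by auto
  have "\<exists>m h'. pcompose h [:[:c:], monom 1 1:] = [:monom 1 m:] * h' \<and> reduce_x h' \<noteq> 0" for c
  proof -
    have "pcompose h [:[:c:], monom 1 1:] \<noteq> 0"
      using hnz by (subst pcompose_eq_0_iff) (auto simp: monom_eq_0_iff)
    then show ?thesis by (rule split_off_x_power) blast
  qed
  then obtain m H where mH: "\<And>c. pcompose h [:[:c:], monom 1 1:] = [:monom 1 (m c):] * H c"
      "\<And>c. reduce_x (H c) \<noteq> 0" by metis
  note ord = reduce_x_branch[OF Suc.prems(1) mH(2) mH(1)]
  \<comment> \<open>The constant coefficient c of the centre selects the branch; the remaining
    digits describe a ball for \<open>H c\<close>, with the weight lowered by the power of x split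
    off.\<close>
  have step: "h \<in> weight_ideal (Suc s) n (pCons c g) \<longleftrightarrow> H c \<in> weight_ideal s (n - m c) g" for s c g
  proof -
    have "[:pCons c g, monom 1 (Suc s):] = pcompose [:[:c:], monom 1 1:] [:g, monom 1 s:]"
      by (simp add: pcompose_pCons mult_monom) (simp add: monom_altdef)
    then have "pcompose h [:pCons c g, monom 1 (Suc s):] =
        pcompose (pcompose h [:[:c:], monom 1 1:]) [:g, monom 1 s:]"
      by (simp only: pcompose_assoc)
    also have "\<dots> = [:monom 1 (m c):] * pcompose (H c) [:g, monom 1 s:]"
      by (simp only: mH(1) pcompose_mult pcompose_const)
    finally show ?thesis
      by (simp add: weight_ideal_def const_poly_dvd_iff monom_1_dvd_monom_mult_iff)
  qed
  have card_le: "card (minimal_balls (n - m c) r (H c)) \<le> Polynomial.order c (reduce_x h)" for c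
  proof (cases "m c < n")
    case True
    then have "card (minimal_balls (n - m c) r (H c)) \<le> degree (reduce_x (H c))"
      using Suc.IH[OF mH(2)] by simp
    then show ?thesis using ord(2) order_trans by blast
  next
    case False
    \<comment> \<open>No weight is left, so at most the trivial ball remains; it is paid for by the
      multiplicity, which is at least \<open>m c \<ge> n > 0\<close>.\<close>
    then have "Polynomial.order c (reduce_x h) \<ge> 1" using ord(1)[of c] Suc.prems(2) by linarith
    moreover have "minimal_balls (n - m c) r (H c) \<subseteq> {0}"
    proof
      fix g assume g: "g \<in> minimal_balls (n - m c) r (H c)"
      have "H c \<in> weight_ideal 0 (n - m c) g"
        using False by (simp add: weight_ideal_def monom_eq_1 const_poly_dvd_iff)
      then have "r = 0" using g by (auto simp: minimal_balls_def)
      then show "g \<in> {0}" using g by (simp add: minimal_balls_def polys_below_0)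
    qed
    then have "card (minimal_balls (n - m c) r (H c)) \<le> 1"
      using card_mono[of "{0 :: 'a poly}"] by fastforce
    ultimately show ?thesis by simp
  qed
  have "minimal_balls n (Suc r) h \<subseteq> (\<Union>c\<in>UNIV. pCons c ` minimal_balls (n - m c) r (H c))"
  proof
    fix g assume g: "g \<in> minimal_balls n (Suc r) h"
    then obtain c g' where g': "g = pCons c g'" "g' \<in> polys_below r"
      by (auto simp: minimal_balls_def polys_below_Suc)
    have "g' \<in> minimal_balls (n - m c) r (H c)"
      using g g' by (auto simp: minimal_balls_def step[symmetric])
    then show "g \<in> (\<Union>c\<in>UNIV. pCons c ` minimal_balls (n - m c) r (H c))" using g' by blast
  qed
  then have "card (minimal_balls n (Suc r) h) \<le> card (\<Union>c\<in>UNIV. pCons c ` minimal_balls (n - m c) r (H c))"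
    by (intro card_mono) (auto intro: finite_minimal_balls)
  also have "\<dots> \<le> (\<Sum>c\<in>UNIV. card (pCons c ` minimal_balls (n - m c) r (H c)))"
    by (rule card_UN_le) simp
  also have "\<dots> \<le> (\<Sum>c\<in>UNIV. Polynomial.order c (reduce_x h))"
    by (intro sum_mono order_trans[OF card_image_le card_le] finite_minimal_balls)
  also have "\<dots> \<le> degree (reduce_x h)" by (rule sum_order_le_degree) (rule Suc.prems)
  finally show ?case .
qed

section \<open>A weighted Bezout bound\<close>

lemma poly_cutoff_eq_iff:
  "poly_cutoff n p = poly_cutoff n p' \<longleftrightarrow> monom 1 n dvd p - p'" for p p' :: "'a::idom poly"
  by (auto simp: poly_eq_iff coeff_poly_cutoff monom_1_dvd_iff')

text \<open>Applied to the expansion in powers of y - g with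
  \<open>\<beta> k = m - \<sigma> * k\<close>, this is the normal form modulo the polynomials of
  weight at least m.\<close>

definition cutoffs :: "(nat \<Rightarrow> nat) \<Rightarrow> 'a::zero poly poly \<Rightarrow> 'a poly poly" where
  "cutoffs \<beta> p = Abs_poly (\<lambda>k. poly_cutoff (\<beta> k) (coeff p k))"

lemma coeff_cutoffs: "coeff (cutoffs \<beta> p) k = poly_cutoff (\<beta> k) (coeff p k)"
proof -
  have "coeff (cutoffs \<beta> p) = (\<lambda>k. poly_cutoff (\<beta> k) (coeff p k))"
    unfolding cutoffs_def by (rule coeff_Abs_poly[of "degree p"]) (simp add: coeff_eq_0)
  then show ?thesis by simp
qed

lemma cutoffs_in_bipolys_below: "cutoffs \<beta> p \<in> bipolys_below \<beta>"
  by (simp add: bipolys_below_def coeff_cutoffs coeff_poly_cutoff)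

lemma card_le_card_image_mult:
  assumes "finite A" "\<And>y. y \<in> f ` A \<Longrightarrow> card {x \<in> A. f x = y} \<le> b"
  shows "card A \<le> card (f ` A) * b"
proof -
  have "A = (\<Union>y\<in>f ` A. {x \<in> A. f x = y})" by auto
  then have "card A \<le> (\<Sum>y\<in>f ` A. card {x \<in> A. f x = y})"
    using card_UN_le[of "f ` A" "\<lambda>y. {x \<in> A. f x = y}"] assms(1) by auto
  also have "\<dots> \<le> (\<Sum>y\<in>f ` A. b)" using assms(2) by (rule sum_mono)
  finally show ?thesis by simp
qed

lemma card_field_ge_2: "CARD('a::{field,finite}) \<ge> 2"
proof -
  have "card {0, 1 :: 'a} \<le> CARD('a)" by (rule card_mono) auto
  then show ?thesis by simp
qed

lemma pcompose_shift_inverse: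
  "pcompose (pcompose f [:- g, 1:]) [:g, 1:] = f" for f :: "'a::comm_ring_1 poly"
proof -
  have "pcompose [:- g, 1:] [:g, 1:] = [:0, 1:]" by (simp add: pcompose_pCons)
  then show ?thesis by (metis pcompose_assoc pcompose_idR)
qed

text \<open>
  In the style of Bezout's theorem: modulo weight \<open>2 M\<close> there are \<open>\<Sum>\<^sub>k (2 M - \<sigma> k)\<close> independent polynomials,
  whereas \<open>h A + h' B\<close> only depends on \<open>A\<close> and \<open>B\<close> modulo weight \<open>M\<close>. Hence the quotient of the polynomials
  of large degree \<open>n\<close> by \<open>(h, h')\<close>, of dimension \<open>d d'\<close>, has at least the dimension claimed.
\<close>

lemma weighted_bezout:
  fixes h h' :: "'a::{field,finite} poly poly"
  assumes h: "h \<in> weight_ideal \<sigma> M g" and h': "h' \<in> weight_ideal \<sigma> M g" and \<sigma>: "\<sigma> > 0"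
    and prime: "prime_elem h'" and ndvd: "\<not> h' dvd h" and K: "K \<ge> 2 * M"
  shows "(\<Sum>k<K. 2 * M - \<sigma> * k) \<le> 2 * (\<Sum>k<K. M - \<sigma> * k) + total_degree h * total_degree h'"
proof -
  define d d' where "d = total_degree h" and "d' = total_degree h'"
  define q where "q = CARD('a)"
  have q: "q > 1" using card_field_ge_2[where 'a = 'a] by (simp add: q_def)
  define \<beta> where "\<beta> m k = m - \<sigma> * k" for m k :: nat
  have \<beta>0: "\<beta> m i = 0" if "m \<le> 2 * M" "i \<ge> K" for m i
  proof -
    have "i \<le> \<sigma> * i" using \<sigma> by simp
    then show ?thesis using that K unfolding \<beta>_def by linarith
  qed
  \<comment> \<open>Representatives of all classes modulo weight 2 M, written in powers of y -
    g.\<close>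
  define C where "C = (\<lambda>f. pcompose f [:- g, 1:]) ` bipolys_below (\<beta> (2 * M))"
  have "inj_on (\<lambda>f. pcompose f [:- g, 1:]) (bipolys_below (\<beta> (2 * M)))"
    by (rule inj_on_inverseI[where g = "\<lambda>f. pcompose f [:g, 1:]"]) (rule pcompose_shift_inverse)
  then have cardC: "card C = q ^ (\<Sum>k<K. 2 * M - \<sigma> * k)"
    unfolding C_def by (simp add: card_image card_bipolys_below[of K] \<beta>0 q_def) (simp add: \<beta>_def)
  have finC: "finite C"
    unfolding C_def by (intro finite_imageI finite_bipolys_below[of K]) (simp add: \<beta>0)
  have C_eq: "c = c'" if cC: "c \<in> C" "c' \<in> C" "c - c' \<in> weight_ideal \<sigma> (2 * M) g" for c c'
  proof -
    obtain f f' where f: "c = pcompose f [:- g, 1:]" "c' = pcompose f' [:- g, 1:]"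
        "f \<in> bipolys_below (\<beta> (2 * M))" "f' \<in> bipolys_below (\<beta> (2 * M))"
      using cC(1,2) by (auto simp: C_def)
    have "pcompose (c - c') [:g, 1:] = f - f'"
      by (simp only: f pcompose_diff pcompose_shift_inverse)
    then have dvd: "monom 1 (\<beta> (2 * M) k) dvd coeff (f - f') k" for k
      using that(3) unfolding weight_ideal_iff \<beta>_def by simp
    have "coeff (coeff (f - f') k) j = 0" for k j
    proof (cases "j < \<beta> (2 * M) k")
      case True then show ?thesis using dvd[of k] by (simp add: monom_1_dvd_iff')
    next
      case False then show ?thesis using f(3,4) by (simp add: bipolys_below_def)
    qed
    then have "f - f' = 0" by (simp add: poly_eq_iff)
    then show ?thesis using f by simp
  qed
  \<comment> \<open>Large enough for \<open>C\<close> to lie in \<open>bideg n\<close>, and at least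
    \<open>d + d'\<close>, so that the subtractions below are exact.\<close>
  define n where "n = Max (insert 0 (total_degree ` C)) + d + d'"
  have Cn: "c \<in> bideg n" if "c \<in> C" for c
  proof -
    have "total_degree c \<le> Max (insert 0 (total_degree ` C))" using finC that by (intro Max_ge) auto
    then show ?thesis unfolding total_degree_le_iff[symmetric] n_def by simp
  qed
  define dom where "dom = C \<times> (bideg (n - d) :: 'a poly poly set) \<times> (bideg (n - d') :: 'a poly poly set)"
  define \<Psi> where "\<Psi> = (\<lambda>(c, A, B). c + h * A + h' * B)"
  have findom: "finite dom" unfolding dom_def using finC by (simp add: finite_bideg)
  have hd: "h \<in> bideg d" "h' \<in> bideg d'" by (simp_all add: d_def d'_def flip: total_degree_le_iff)
  have "\<Psi> ` dom \<subseteq> bideg n"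
  proof
    fix v assume "v \<in> \<Psi> ` dom"
    then obtain c A B where v: "v = c + h * A + h' * B" "c \<in> C" "A \<in> bideg (n - d)" "B \<in> bideg (n - d')"
      by (auto simp: dom_def \<Psi>_def)
    have "h * A \<in> bideg (d + (n - d))" "h' * B \<in> bideg (d' + (n - d'))"
      using v hd by (auto intro: bideg_mult)
    moreover have "d + (n - d) = n" "d' + (n - d') = n" by (simp_all add: n_def)
    ultimately have "h * A \<in> bideg n" "h' * B \<in> bideg n" by metis+
    then show "v \<in> bideg n" using Cn[OF v(2)] unfolding v(1) bideg_def by (intro bipolys_below_add)
  qed
  then have im: "card (\<Psi> ` dom) \<le> card (bideg n :: 'a poly poly set)"
    by (intro card_mono finite_bideg)
  define cl where "cl A = cutoffs (\<beta> M) (pcompose A [:g, 1:])" for A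
  have clD: "A - A' \<in> weight_ideal \<sigma> M g" if "cl A = cl A'" for A A'
    unfolding weight_ideal_iff
  proof
    fix k
    have "coeff (cl A) k = coeff (cl A') k" using that by simp
    then show "monom 1 (M - \<sigma> * k) dvd coeff (pcompose (A - A') [:g, 1:]) k"
      by (simp add: cl_def coeff_cutoffs poly_cutoff_eq_iff pcompose_diff \<beta>_def)
  qed
  have fin\<beta>: "finite (bipolys_below (\<beta> M) :: 'a poly poly set)"
    by (rule finite_bipolys_below[of K]) (simp add: \<beta>0)
  have card\<beta>: "card (bipolys_below (\<beta> M) :: 'a poly poly set) = q ^ (\<Sum>k<K. M - \<sigma> * k)"
    by (subst card_bipolys_below[of K]) (simp_all add: \<beta>0 q_def, simp add: \<beta>_def)
  have h'nz: "h' \<noteq> 0" using prime by auto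
  \<comment> \<open>Fixing A and B modulo weight M fixes c, because
    \<open>h * (A - A0) + h' * (B - B0)\<close> then has weight 2 M. What remains is the relation
    \<open>h * (A - A0) = h' * (B0 - B)\<close>, and primality of \<open>h'\<close> makes A - A0 a
    multiple of \<open>h'\<close>.\<close>
  have fibre: "card {x \<in> dom. \<Psi> x = v} \<le>
      q ^ (2 * (\<Sum>k<K. M - \<sigma> * k)) * card (bideg (n - d - d') :: 'a poly poly set)" for v
  proof -
    define F where "F = {x \<in> dom. \<Psi> x = v}"
    define key where "key = (\<lambda>(c :: 'a poly poly, A, B). (cl A, cl B))"
    have finF: "finite F" using findom by (simp add: F_def)
    have "key ` F \<subseteq> bipolys_below (\<beta> M) \<times> bipolys_below (\<beta> M)"
      by (auto simp: key_def cl_def cutoffs_in_bipolys_below)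
    then have "card (key ` F) \<le> card (bipolys_below (\<beta> M) \<times> bipolys_below (\<beta> M) :: ('a poly poly \<times> 'a poly poly) set)"
      by (intro card_mono) (simp_all add: fin\<beta>)
    also have "\<dots> = q ^ (2 * (\<Sum>k<K. M - \<sigma> * k))"
      by (simp add: card_cartesian_product card\<beta> power_add[symmetric] mult_2)
    finally have key: "card (key ` F) \<le> q ^ (2 * (\<Sum>k<K. M - \<sigma> * k))" .
    have "card {x \<in> F. key x = y} \<le> card (bideg (n - d - d') :: 'a poly poly set)" if "y \<in> key ` F" for y
    proof -
      obtain c0 A0 B0 where x0: "(c0, A0, B0) \<in> F" "key (c0, A0, B0) = y" using \<open>y \<in> key ` F\<close> by auto
      have main: "c = c0 \<and> h * (A - A0) = h' * (B0 - B)" if "(c, A, B) \<in> F" "key (c, A, B) = y" for c A B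
      proof -
        have "cl A = cl A0" "cl B = cl B0" using that(2) x0(2) by (auto simp: key_def)
        then have "h * (A - A0) \<in> weight_ideal \<sigma> (M + M) g" "h' * (B - B0) \<in> weight_ideal \<sigma> (M + M) g"
          using h h' by (auto intro!: weight_ideal_mult clD)
        then have "h * (A - A0) + h' * (B - B0) \<in> weight_ideal \<sigma> (2 * M) g"
          unfolding mult_2 by (rule weight_ideal_add)
        moreover have eq: "c0 + h * A0 + h' * B0 = c + h * A + h' * B"
          using that(1) x0(1) by (simp add: F_def \<Psi>_def)
        then have "h * (A - A0) + h' * (B - B0) = c0 - c" by (simp add: algebra_simps)
        ultimately have "c0 - c \<in> weight_ideal \<sigma> (2 * M) g" by simp
        then have "c0 = c" using that(1) x0(1) by (intro C_eq) (auto simp: F_def dom_def)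
        with eq show ?thesis by (simp add: algebra_simps)
      qed
      have "inj_on (\<lambda>(c, A, B). A) {x \<in> F. key x = y}"
      proof (rule inj_onI)
        fix x x' assume x: "x \<in> {x \<in> F. key x = y}" "x' \<in> {x \<in> F. key x = y}"
          and eqA: "(case x of (c, A, B) \<Rightarrow> A) = (case x' of (c, A, B) \<Rightarrow> A)"
        obtain c A B where X: "x = (c, A, B)" by (cases x)
        obtain c' A' B' where X': "x' = (c', A', B')" by (cases x')
        have "c = c0" "h * (A - A0) = h' * (B0 - B)" using main x(1) X by auto
        moreover have "c' = c0" "h * (A' - A0) = h' * (B0 - B')" using main x(2) X' by auto
        moreover have "A = A'" using eqA X X' by simp
        ultimately show "x = x'" using h'nz X X' by auto
      qed
      moreover have "(\<lambda>(c, A, B). A) ` {x \<in> F. key x = y} \<subseteq> (\<lambda>T. A0 + h' * T) ` bideg (n - d - d')"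
      proof
        fix A assume "A \<in> (\<lambda>(c, A, B). A) ` {x \<in> F. key x = y}"
        then obtain c B where x: "(c, A, B) \<in> F" "key (c, A, B) = y" by auto
        have "h * (A - A0) = h' * (B0 - B)" using main[OF x] by blast
        then have "h' dvd h * (A - A0)" by (rule dvdI)
        then have "h' dvd A - A0" using prime_elem_dvd_multD[OF prime] ndvd by blast
        then obtain T where T: "A - A0 = h' * T" by (rule dvdE)
        have "A - A0 \<in> bideg (n - d)"
          using x(1) x0(1) by (auto simp: F_def dom_def bideg_def intro: bipolys_below_diff)
        then have le: "total_degree (h' * T) \<le> n - d" by (simp add: T total_degree_le_iff)
        have "T \<in> bideg (n - d - d')"
        proof (cases "T = 0")
          case False
          then show ?thesis using le total_degree_mult[OF h'nz False]
            by (simp add: d'_def flip: total_degree_le_iff)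
        qed (simp add: bideg_iff)
        moreover have "A = A0 + h' * T" using T by (simp add: algebra_simps)
        ultimately show "A \<in> (\<lambda>T. A0 + h' * T) ` bideg (n - d - d')" by blast
      qed
      ultimately have "card {x \<in> F. key x = y} \<le> card ((\<lambda>T. A0 + h' * T) ` (bideg (n - d - d') :: 'a poly poly set))"
        by (rule card_inj_on_le) (intro finite_imageI finite_bideg)
      also have "\<dots> \<le> card (bideg (n - d - d') :: 'a poly poly set)" by (rule card_image_le) (rule finite_bideg)
      finally show ?thesis .
    qed
    from card_le_card_image_mult[OF finF this]
    have "card F \<le> card (key ` F) * card (bideg (n - d - d') :: 'a poly poly set)" by simp
    also have "\<dots> \<le> q ^ (2 * (\<Sum>k<K. M - \<sigma> * k)) * card (bideg (n - d - d') :: 'a poly poly set)"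
      using key by (rule mult_right_mono) simp
    finally show ?thesis by (simp add: F_def)
  qed
  define D where "D k = Suc k * (k + 2) div 2" for k
  have "card dom \<le> card (\<Psi> ` dom) * (q ^ (2 * (\<Sum>k<K. M - \<sigma> * k)) * card (bideg (n - d - d') :: 'a poly poly set))"
    using findom fibre by (rule card_le_card_image_mult)
  also have "\<dots> \<le> card (bideg n :: 'a poly poly set) * (q ^ (2 * (\<Sum>k<K. M - \<sigma> * k)) * card (bideg (n - d - d') :: 'a poly poly set))"
    using im by (rule mult_right_mono) simp
  finally have "q ^ ((\<Sum>k<K. 2 * M - \<sigma> * k) + D (n - d) + D (n - d')) \<le>
      q ^ (D n + 2 * (\<Sum>k<K. M - \<sigma> * k) + D (n - d - d'))"
    unfolding dom_def card_cartesian_product cardC card_bideg q_def[symmetric] D_def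
    by (simp only: power_add mult.assoc)
  then have "(\<Sum>k<K. 2 * M - \<sigma> * k) + D (n - d) + D (n - d') \<le>
      D n + 2 * (\<Sum>k<K. M - \<sigma> * k) + D (n - d - d')"
    using q by simp
  \<comment> \<open>This second difference of the monomial count \<open>D\<close> is where the
    product of the degrees arises.\<close>
  moreover have "D n + D (n - d - d') = D (n - d) + D (n - d') + d * d'"
  proof -
    have D2: "2 * D k = (k + 1) * (k + 2)" for k by (simp add: D_def)
    define r where "r = n - d - d'"
    have r: "n = r + d + d'" "n - d = r + d'" "n - d' = r + d" by (auto simp: r_def n_def)
    have "2 * (D n + D (n - d - d')) = 2 * (D (n - d) + D (n - d') + d * d')"
      unfolding distrib_left D2 r by (simp add: algebra_simps)
    then show ?thesis by simp
  qed
  ultimately show ?thesis unfolding d_def d'_def by linarith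
qed

text \<open>The difference \<phi> of the summands is a tent: it equals \<sigma> k up to j = M div
  \<sigma> and falls afterwards. Since j \<ge> 2, the values up to j add up to at least \<sigma> (j
  + 1), and the value 2 M - \<sigma> (j + 1) at j + 1 completes the sum to 2 M.\<close>

lemma tent_sum:
  fixes \<sigma> M :: nat
  assumes "\<sigma> > 0" "M \<ge> 2 * \<sigma>"
  shows "2 * M + 2 * (\<Sum>k<2 * M. M - \<sigma> * k) \<le> (\<Sum>k<2 * M. 2 * M - \<sigma> * k)"
proof -
  define j where "j = M div \<sigma>"
  have j: "\<sigma> * j \<le> M" "M < \<sigma> * Suc j" "j \<ge> 2"
    using assms dividend_less_times_div[of \<sigma> M] div_le_mono[of "2 * \<sigma>" M \<sigma>] by (auto simp: j_def)
  have "\<sigma> * Suc j \<le> 2 * M" using j(1) assms by simp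
  have "j \<le> \<sigma> * j" using assms by simp
  then have "Suc j < 2 * M" using j assms by linarith
  define \<phi> where "\<phi> k = (2 * M - \<sigma> * k) - 2 * (M - \<sigma> * k)" for k
  have sum_id: "2 * (\<Sum>k\<le>j. k) = j * Suc j" by (induction j) auto
  have "\<sigma> * (2 * Suc j) \<le> \<sigma> * (j * Suc j)" using j(3) by (intro mult_le_mono) auto
  also have "\<dots> = 2 * (\<Sum>k\<le>j. \<sigma> * k)" unfolding sum_id[symmetric] by (simp add: sum_distrib_left mult.left_commute)
  finally have 1: "\<sigma> * Suc j \<le> (\<Sum>k\<le>j. \<sigma> * k)" by simp
  have "\<phi> k = \<sigma> * k" if "k \<le> j" for k
  proof -
    have "\<sigma> * k \<le> M" using that j(1) by (meson le_trans mult_le_mono2)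
    then show ?thesis by (simp add: \<phi>_def)
  qed
  then have "(\<Sum>k\<le>j. \<phi> k) = (\<Sum>k\<le>j. \<sigma> * k)" by simp
  moreover have "\<phi> (Suc j) = 2 * M - \<sigma> * Suc j" using j(2) by (simp add: \<phi>_def)
  ultimately have "2 * M \<le> (\<Sum>k\<le>Suc j. \<phi> k)" using 1 by simp
  also have "\<dots> \<le> (\<Sum>k<2 * M. \<phi> k)" using \<open>Suc j < 2 * M\<close> by (intro sum_mono2) auto
  finally have le: "2 * M \<le> (\<Sum>k<2 * M. \<phi> k)" .
  have "2 * M - \<sigma> * k = \<phi> k + 2 * (M - \<sigma> * k)" for k
    unfolding \<phi>_def by (cases "\<sigma> * k \<le> M") linarith+
  then have "(\<Sum>k<2 * M. 2 * M - \<sigma> * k) = (\<Sum>k<2 * M. \<phi> k + 2 * (M - \<sigma> * k))" by (simp only:)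
  also have "\<dots> = (\<Sum>k<2 * M. \<phi> k) + 2 * (\<Sum>k<2 * M. M - \<sigma> * k)"
    by (simp only: sum.distrib sum_distrib_left)
  finally have eq: "(\<Sum>k<2 * M. 2 * M - \<sigma> * k) = (\<Sum>k<2 * M. \<phi> k) + 2 * (\<Sum>k<2 * M. M - \<sigma> * k)" .
  show ?thesis unfolding eq using le by (rule add_right_mono)
qed

text \<open>If divisibility failed, the Bezout inequality would leave
  \<open>2 * M \<le> d * d\<close>. Hence the residue of g modulo x^\<sigma> determines such an h up
  to a constant.\<close>

lemma irreducible_in_weight_ideal_unique:
  fixes h h' :: "'a::{field,finite} poly poly"
  assumes "irreducible h" "irreducible h'" "h \<in> weight_ideal \<sigma> M g" "h' \<in> weight_ideal \<sigma> M g"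
    and "total_degree h \<le> d" "total_degree h' \<le> d" "\<sigma> > 0" "M \<ge> 2 * \<sigma>" "d * d < 2 * M"
  shows "h' dvd h"
proof (rule ccontr)
  assume nd: "\<not> h' dvd h"
  have "prime_elem h'" using assms(2) by (simp only: prime_elem_iff_irreducible)
  from order_trans[OF tent_sum[OF assms(7,8)] weighted_bezout[OF assms(3,4,7) this nd order_refl]]
  have "2 * M \<le> total_degree h * total_degree h'"
    by (simp only: add.commute[of "2 * M"] add_le_cancel_left)
  also have "\<dots> \<le> d * d" using assms(5,6) by (rule mult_le_mono)
  finally show False using assms(9) by simp
qed

section \<open>Prefixes annihilated by an irreducible polynomial\<close>

lemma monom_dvd_diff_poly_cutoff: "t' \<le> t \<Longrightarrow> monom 1 t' dvd p - poly_cutoff t p"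
  for p :: "'a::idom poly"
  by (simp add: monom_1_dvd_iff' coeff_poly_cutoff)

lemma weight_ideal_cutoff: "t' \<le> t \<Longrightarrow> weight_ideal t' n (poly_cutoff t g) = weight_ideal t' n g"
  by (rule weight_ideal_cong) (rule monom_dvd_diff_poly_cutoff)

lemma poly_cutoff_in_polys_below: "poly_cutoff n p \<in> polys_below n"
  by (simp add: polys_below_def coeff_poly_cutoff)

lemma minimal_ball_exists:
  assumes "h \<in> weight_ideal N N g"
  obtains t where "t \<le> N" "poly_cutoff t g \<in> minimal_balls N t h"
proof -
  define t where "t = (LEAST t. h \<in> weight_ideal t N g)"
  have t: "h \<in> weight_ideal t N g" unfolding t_def using assms by (rule LeastI)
  have "t \<le> N" unfolding t_def using assms by (rule Least_le)
  moreover have "h \<notin> weight_ideal t' N g" if "t' < t" for t'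
    using that not_less_Least unfolding t_def by blast
  then have "poly_cutoff t g \<in> minimal_balls N t h"
    unfolding minimal_balls_def using t
    by (simp add: poly_cutoff_in_polys_below weight_ideal_cutoff)
  ultimately show thesis by (rule that)
qed

text \<open>Otherwise h would be x times a unit and free of y, against the positive y-degree forced
  by vanishing to order N > d.\<close>

lemma reduce_x_nonzero:
  fixes h :: "'a::{field,finite} poly poly"
  assumes h: "irreducible h" "h \<in> weight_ideal t N g" and d: "total_degree h \<le> d" "d < N"
  shows "reduce_x h \<noteq> 0"
proof
  assume "reduce_x h = 0"
  then obtain k where k: "h = [:monom 1 1:] * k" unfolding reduce_x_eq_0_iff by blast
  have "\<not> is_unit ([:monom 1 1:] :: 'a poly poly)"
  proof
    assume "is_unit ([:monom 1 1:] :: 'a poly poly)"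
    then have "is_unit (monom 1 1 :: 'a poly)" by (simp only: is_unit_const_poly_iff)
    then have "degree (monom 1 1 :: 'a poly) = 0" by (rule poly_dvd_1[THEN iffD1, THEN conjunct1])
    then show False by (simp add: degree_monom_eq)
  qed
  then have "is_unit k" using irreducibleD[OF h(1) k] by blast
  then have "degree k = 0" by (rule poly_dvd_1[THEN iffD1, THEN conjunct1])
  then have "degree h = 0" unfolding k by (metis add_0 degree_mult_le degree_pCons_0 le_zero_eq)
  moreover have "h \<noteq> 0" using h(1) by auto
  ultimately show False using weight_ideal_degree_bound(2)[OF h(2) _ d] by simp
qed

lemma card_minimal_balls_irreducible:
  fixes h :: "'a::{field,finite} poly poly"
  assumes h: "irreducible h" and d: "total_degree h \<le> d" "d < N"
  shows "card (minimal_balls N t h) \<le> d"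
proof (cases "minimal_balls N t h = {}")
  case False
  then obtain g where "h \<in> weight_ideal t N g" by (auto simp: minimal_balls_def)
  then have "card (minimal_balls N t h) \<le> degree (reduce_x h)"
    using reduce_x_nonzero[OF h _ d] d by (intro card_minimal_balls) auto
  also have "\<dots> \<le> d"
    using degree_reduce_x_le degree_le_total_degree d(1) by (meson order_trans)
  finally show ?thesis .
qed simp

lemma card_ball_le:
  assumes "t \<le> N"
  shows "card {g \<in> polys_below N. poly_cutoff t g = (g0 :: 'a::{field,finite} poly)} \<le> CARD('a) ^ (N - t)"
proof -
  have "inj_on (poly_shift t) {g \<in> polys_below N. poly_cutoff t g = g0}"
  proof (rule inj_onI)
    fix f g assume fg: "f \<in> {g \<in> polys_below N. poly_cutoff t g = g0}"
      "g \<in> {g \<in> polys_below N. poly_cutoff t g = g0}" "poly_shift t f = poly_shift t g"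
    show "f = g"
    proof (rule poly_eqI)
      fix n show "coeff f n = coeff g n"
      proof (cases "n < t")
        case True
        have "coeff (poly_cutoff t f) n = coeff (poly_cutoff t g) n" using fg by simp
        then show ?thesis using True by (simp add: coeff_poly_cutoff)
      next
        case False
        have "coeff (poly_shift t f) (n - t) = coeff (poly_shift t g) (n - t)" using fg by simp
        then show ?thesis using False by (simp add: coeff_poly_shift)
      qed
    qed
  qed
  moreover have "poly_shift t ` {g \<in> polys_below N. poly_cutoff t g = g0} \<subseteq> polys_below (N - t)"
    by (auto simp: polys_below_def coeff_poly_shift)
  ultimately have "card {g \<in> polys_below N. poly_cutoff t g = g0} \<le> card (polys_below (N - t) :: 'a poly set)"
    by (rule card_inj_on_le) (rule finite_polys_below)
  then show ?thesis by (simp add: card_polys_below)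
qed

text \<open>Sorts the prefixes by the radius exponent t of a minimal ball. The set \<open>A\<close>
  will hold the prefixes that avoid annihilators of low degree for the previous \<kappa>.\<close>

definition level_set :: "'a::idom poly set \<Rightarrow> nat \<Rightarrow> nat \<Rightarrow> nat \<Rightarrow> 'a poly set" where
  "level_set A N d t =
     {g \<in> A. \<exists>h. irreducible h \<and> total_degree h \<le> d \<and> poly_cutoff t g \<in> minimal_balls N t h}"

lemma level_set_witness:
  assumes "g \<in> level_set A N d t"
  obtains h where "irreducible h" "total_degree h \<le> d" "poly_cutoff t g \<in> minimal_balls N t h"
    "h \<in> weight_ideal t N g"
  using assms by (auto simp: level_set_def minimal_balls_def weight_ideal_cutoff)

text \<open>The resulting bound t \<ge> N / d turns a saving proportional to t into one of order
  sqrt N.\<close>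

lemma level_set_nonempty_bound:
  assumes "g \<in> level_set A N d t" "d < N"
  shows "N \<le> t * d"
proof -
  obtain h where "irreducible h" "total_degree h \<le> d" "h \<in> weight_ideal t N g"
    using level_set_witness[OF assms(1)] by blast
  moreover from this have "h \<noteq> 0" by auto
  ultimately show ?thesis using weight_ideal_degree_bound(1) assms(2) by blast
qed

text \<open>Every h has at most d minimal balls, and each ball contains at most q^(N - t) prefixes.
  The set \<open>H\<close> may consist of one representative per class of associated
  polynomials.\<close>

lemma card_level_set_le:
  fixes A :: "'a::{field,finite} poly set"
  assumes A: "A \<subseteq> polys_below N" and t: "t \<le> N" and d: "d < N" and H: "finite H"
    and irr: "\<And>h. h \<in> H \<Longrightarrow> irreducible h \<and> total_degree h \<le> d"
    and cover: "\<And>g. g \<in> level_set A N d t \<Longrightarrow> \<exists>h\<in>H. poly_cutoff t g \<in> minimal_balls N t h"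
  shows "card (level_set A N d t) \<le> card H * d * CARD('a) ^ (N - t)"
proof -
  let ?B = "\<lambda>g0 :: 'a poly. {g \<in> polys_below N. poly_cutoff t g = g0}"
  have finB: "finite (?B g0)" for g0
    by (rule finite_subset[OF _ finite_polys_below[of N]]) auto
  have "level_set A N d t \<subseteq> (\<Union>h\<in>H. \<Union>g0\<in>minimal_balls N t h. ?B g0)"
    using cover A by (fastforce simp: level_set_def)
  then have "card (level_set A N d t) \<le> card (\<Union>h\<in>H. \<Union>g0\<in>minimal_balls N t h. ?B g0)"
    by (intro card_mono finite_UN_I finB H finite_minimal_balls)
  also have "\<dots> \<le> (\<Sum>h\<in>H. card (\<Union>g0\<in>minimal_balls N t h. ?B g0))" by (rule card_UN_le) (rule H)
  also have "\<dots> \<le> (\<Sum>h\<in>H. d * CARD('a) ^ (N - t))"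
  proof (rule sum_mono)
    fix h assume h: "h \<in> H"
    have "card (\<Union>g0\<in>minimal_balls N t h. ?B g0) \<le> (\<Sum>g0\<in>minimal_balls N t h. card (?B g0))"
      by (rule card_UN_le) (rule finite_minimal_balls)
    also have "\<dots> \<le> card (minimal_balls N t h) * CARD('a) ^ (N - t)"
      using sum_bounded_above[of "minimal_balls N t h" "\<lambda>g0. card (?B g0)", OF card_ball_le[OF t]] by simp
    also have "\<dots> \<le> d * CARD('a) ^ (N - t)"
      using card_minimal_balls_irreducible irr[OF h] d by (intro mult_right_mono) auto
    finally show "card (\<Union>g0\<in>minimal_balls N t h. ?B g0) \<le> d * CARD('a) ^ (N - t)" .
  qed
  finally show ?thesis by simp
qed

lemma minimal_balls_dvd_cong:
  assumes "h dvd h'" "h' dvd h"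
  shows "minimal_balls n r h = minimal_balls n r h'"
proof -
  have "h \<in> weight_ideal t n g \<longleftrightarrow> h' \<in> weight_ideal t n g" for t g
    using assms weight_ideal_mult_right by (metis dvdE)
  then show ?thesis by (simp add: minimal_balls_def)
qed

text \<open>The pair \<open>(t0, N0)\<close> will be (t, N) or (u, 2 u). The scale \<sigma> is the
  least with \<open>d * d * t0 < 2 * N0 * \<sigma>\<close>; then the rescaled weight M exceeds
  \<open>d * d / 2\<close>, and each residue modulo x^\<sigma> leaves at most one h up to a
  constant.\<close>

lemma card_level_set_bezout:
  fixes A :: "'a::{field,finite} poly set"
  assumes A: "A \<subseteq> polys_below N" and t: "t \<le> N" and d: "d < N"
    and t0: "t0 > 0" "2 * t0 \<le> N0" "d * d < 2 * N0"
    and W: "\<And>h g. h \<in> weight_ideal t N g \<Longrightarrow> h \<in> weight_ideal t0 N0 (g :: 'a poly)"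
  shows "card (level_set A N d t) \<le> CARD('a) ^ (d * d * t0 div (2 * N0) + 1) * d * CARD('a) ^ (N - t)"
proof -
  define \<sigma> where "\<sigma> = d * d * t0 div (2 * N0) + 1"
  \<comment> \<open>This is \<open>N0 * \<sigma> / t0\<close> rounded up, the largest weight that
    rescaling to \<sigma> allows.\<close>
  define M where "M = (N0 * \<sigma> + t0 - 1) div t0"
  have N0: "N0 > 0" using t0 by linarith
  have "d * d * t0 < t0 * (2 * N0)" using t0 by (simp add: mult.commute)
  then have "d * d * t0 div (2 * N0) < t0" by (rule less_mult_imp_div_less)
  then have st: "\<sigma> \<le> t0" by (simp add: \<sigma>_def)
  have \<sigma>1: "\<sigma> > 0" by (simp add: \<sigma>_def)
  have Mt: "M * t0 < N0 * \<sigma> + t0"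
  proof -
    have "M * t0 \<le> N0 * \<sigma> + t0 - 1" unfolding M_def by (rule div_times_less_eq_dividend)
    then show ?thesis using t0 by linarith
  qed
  have Mt': "N0 * \<sigma> \<le> M * t0"
    using dividend_less_div_times[of t0 "N0 * \<sigma> + t0 - 1"] t0 unfolding M_def[symmetric] by linarith
  have "2 * \<sigma> * t0 \<le> N0 * \<sigma>" using t0(2) by (simp add: mult.commute mult.left_commute)
  then have "2 * \<sigma> * t0 \<le> M * t0" using Mt' by linarith
  then have M2: "2 * \<sigma> \<le> M" using t0(1) by simp
  have "d * d * t0 < 2 * N0 * \<sigma>"
    using dividend_less_times_div[of "2 * N0" "d * d * t0"] N0 by (simp add: \<sigma>_def)
  then have "d * d * t0 < (2 * M) * t0" using Mt' by linarith
  then have dM: "d * d < 2 * M" by (rule mult_less_cancel2[THEN iffD1, THEN conjunct2])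
  have W': "h \<in> weight_ideal \<sigma> M (poly_cutoff \<sigma> g)" if "h \<in> weight_ideal t N g" for h and g :: "'a poly"
    using weight_ideal_rescale[OF W[OF that] st Mt] by (simp add: weight_ideal_cutoff)
  define good where "good c h \<longleftrightarrow> irreducible h \<and> total_degree h \<le> d \<and> h \<in> weight_ideal \<sigma> M c"
    for c :: "'a poly" and h
  define pick where "pick c = (SOME h. good c h)" for c
  have pick: "good c (pick c)" if "good c h" for c h
    unfolding pick_def using that by (rule someI)
  define H where "H = pick ` {c \<in> polys_below \<sigma>. \<exists>h. good c h}"
  have fin: "finite {c \<in> polys_below \<sigma>. \<exists>h. good c h}"
    by (rule finite_subset[OF _ finite_polys_below[of \<sigma>]]) auto
  then have finH: "finite H" unfolding H_def by (rule finite_imageI)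
  have "card H \<le> card {c \<in> polys_below \<sigma>. \<exists>h. good c h}"
    unfolding H_def using fin by (rule card_image_le)
  also have "\<dots> \<le> card (polys_below \<sigma> :: 'a poly set)"
    by (rule card_mono) (auto simp: finite_polys_below)
  finally have cardH: "card H \<le> CARD('a) ^ \<sigma>" by (simp add: card_polys_below)
  have "card (level_set A N d t) \<le> card H * d * CARD('a) ^ (N - t)"
  proof (rule card_level_set_le[OF A t d finH])
    show "irreducible h \<and> total_degree h \<le> d" if "h \<in> H" for h
      using that pick by (auto simp: H_def good_def)
    fix g assume "g \<in> level_set A N d t"
    then obtain h where h: "irreducible h" "total_degree h \<le> d" "poly_cutoff t g \<in> minimal_balls N t h"
      "h \<in> weight_ideal t N g" by (rule level_set_witness)
    define c where "c = poly_cutoff \<sigma> g"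
    have good: "good c h" using h W' by (auto simp: good_def c_def)
    note good' = pick[OF good]
    have "h dvd pick c" "pick c dvd h"
      using good good' irreducible_in_weight_ideal_unique[where d = d, OF _ _ _ _ _ _ \<sigma>1 M2 dM]
      unfolding good_def by blast+
    then have "poly_cutoff t g \<in> minimal_balls N t (pick c)" using h(3) minimal_balls_dvd_cong by blast
    moreover have "pick c \<in> H" using good by (auto simp: H_def c_def poly_cutoff_in_polys_below)
    ultimately show "\<exists>h\<in>H. poly_cutoff t g \<in> minimal_balls N t h" by blast
  qed
  also have "\<dots> \<le> CARD('a) ^ \<sigma> * d * CARD('a) ^ (N - t)"
    using cardH by (intro mult_right_mono) auto
  finally show ?thesis by (simp only: \<sigma>_def)
qed

text \<open>Counting all polynomials of degree at most d is good enough while u = N - t stays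
  bounded, where the avoidance hypothesis says nothing.\<close>

lemma card_level_set_trivial:
  fixes A :: "'a::{field,finite} poly set"
  assumes A: "A \<subseteq> polys_below N" and t: "t \<le> N" and d: "d < N"
  shows "card (level_set A N d t) \<le> card (bideg d :: 'a poly poly set) * d * CARD('a) ^ (N - t)"
proof -
  define H where "H = {h :: 'a poly poly. irreducible h \<and> total_degree h \<le> d}"
  have sub: "H \<subseteq> bideg d" by (auto simp: H_def total_degree_le_iff)
  then have finH: "finite H" using finite_bideg by (rule finite_subset)
  have "card (level_set A N d t) \<le> card H * d * CARD('a) ^ (N - t)"
    by (rule card_level_set_le[OF A t d finH]) (auto simp: H_def level_set_def)
  also have "\<dots> \<le> card (bideg d :: 'a poly poly set) * d * CARD('a) ^ (N - t)"
    using sub by (intro mult_right_mono card_mono finite_bideg) auto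
  finally show ?thesis .
qed

text \<open>
  Every \<open>h\<close> in question lies in an ideal that meets \<open>bideg b\<close> trivially, so it contributes at most
  \<open>|bideg d| / |bideg b|\<close> elements for each of the \<open>q\<^sup>u\<close> residues of \<open>g\<close> modulo \<open>x\<^sup>u\<close>.
\<close>

lemma card_level_set_generic:
  fixes A :: "'a::{field,finite} poly set"
  assumes A: "A \<subseteq> polys_below N" and t: "t \<le> N" and d: "d < N" and b: "b \<le> d"
    and u: "u = N - t" "2 * u \<le> N"
    and gen: "\<And>g Q. g \<in> A \<Longrightarrow> Q \<in> bideg b \<Longrightarrow> Q \<noteq> 0 \<Longrightarrow> Q \<notin> weight_ideal (2 * u) (2 * u) g"
  shows "card (level_set A N d t) * card (bideg b :: 'a poly poly set) \<le>
     CARD('a) ^ u * card (bideg d :: 'a poly poly set) * d * CARD('a) ^ u"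
proof -
  let ?Vb = "bideg b :: 'a poly poly set" and ?Vd = "bideg d :: 'a poly poly set"
  define H where "H = {h :: 'a poly poly. irreducible h \<and> total_degree h \<le> d \<and>
      (\<exists>g\<in>A. poly_cutoff t g \<in> minimal_balls N t h)}"
  define X where "X g0 = {h \<in> ?Vd. \<exists>g\<in>A. poly_cutoff u g = g0 \<and> h \<in> weight_ideal u (2 * u) g}" for g0
  have finX: "finite (X g0)" for g0 unfolding X_def using finite_bideg by (rule finite_subset[rotated]) auto
  have "H \<subseteq> ?Vd" by (auto simp: H_def total_degree_le_iff)
  then have finH: "finite H" using finite_bideg by (rule finite_subset)
  have HX: "H \<subseteq> (\<Union>g0\<in>polys_below u. X g0)"
  proof
    fix h assume "h \<in> H"
    then obtain g where g: "g \<in> A" "poly_cutoff t g \<in> minimal_balls N t h" "h \<in> ?Vd"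
      by (auto simp: H_def total_degree_le_iff)
    then have "h \<in> weight_ideal t N g" by (simp add: minimal_balls_def weight_ideal_cutoff)
    then have "h \<in> weight_ideal u (2 * u) g" using u weight_ideal_double by blast
    then have "h \<in> X (poly_cutoff u g)" using g by (auto simp: X_def)
    then show "h \<in> (\<Union>g0\<in>polys_below u. X g0)" using poly_cutoff_in_polys_below by blast
  qed
  have cardX: "card (X g0) * card ?Vb \<le> card ?Vd" for g0
  proof (cases "X g0 = {}")
    case False
    then obtain g where g: "g \<in> A" "poly_cutoff u g = g0" by (auto simp: X_def)
    have XW: "h \<in> weight_ideal u (2 * u) g" if hX: "h \<in> X g0" for h
    proof -
      obtain g' where "poly_cutoff u g' = g0" "h \<in> weight_ideal u (2 * u) g'"
        using hX by (auto simp: X_def)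
      then have "h \<in> weight_ideal u (2 * u) g0" by (metis weight_ideal_cutoff order_refl)
      then show ?thesis using g(2) by (metis weight_ideal_cutoff order_refl)
    qed
    \<comment> \<open>A nonzero difference of two elements of \<open>X g0\<close> that lies in
      \<open>bideg b\<close> would annihilate g modulo x^(2 u), so \<open>h + Q\<close> determines
      both summands.\<close>
    have "inj_on (\<lambda>(h, Q). h + Q) (X g0 \<times> ?Vb)"
    proof (rule inj_onI, clarify)
      fix h Q h' Q' assume *: "h \<in> X g0" "Q \<in> ?Vb" "h' \<in> X g0" "Q' \<in> ?Vb" "h + Q = h' + Q'"
      then have eq: "h - h' = Q' - Q" by (simp add: algebra_simps)
      have "h - h' \<in> weight_ideal u (2 * u) g" using * XW by (intro weight_ideal_diff) auto
      then have "Q' - Q \<in> weight_ideal (2 * u) (2 * u) g"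
        unfolding eq by (rule weight_ideal_shift) auto
      moreover have "Q' - Q \<in> ?Vb" using * unfolding bideg_def by (intro bipolys_below_diff)
      ultimately have "Q' - Q = 0" using gen[OF g(1)] by blast
      then show "h = h' \<and> Q = Q'" using eq by simp
    qed
    moreover have "(\<lambda>(h, Q). h + Q) ` (X g0 \<times> ?Vb) \<subseteq> ?Vd"
    proof -
      have "?Vb \<subseteq> ?Vd" using b by (fastforce simp: bideg_iff)
      then show ?thesis by (auto simp: X_def bideg_def intro!: bipolys_below_add)
    qed
    ultimately have "card (X g0 \<times> ?Vb) \<le> card ?Vd" by (rule card_inj_on_le) (rule finite_bideg)
    then show ?thesis by (simp add: card_cartesian_product)
  qed simp
  have "card H \<le> card (\<Union>g0\<in>polys_below u. X g0)"
    using HX by (intro card_mono) (auto simp: finite_polys_below finX)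
  also have "\<dots> \<le> (\<Sum>g0\<in>polys_below u. card (X g0))" by (rule card_UN_le) (rule finite_polys_below)
  finally have "card H * card ?Vb \<le> (\<Sum>g0\<in>polys_below u. card (X g0)) * card ?Vb" by (rule mult_right_mono) simp
  also have "\<dots> = (\<Sum>g0\<in>polys_below u. card (X g0) * card ?Vb)" by (rule sum_distrib_right)
  also have "\<dots> \<le> (\<Sum>g0\<in>(polys_below u :: 'a poly set). card ?Vd)" using cardX by (rule sum_mono)
  finally have cardH: "card H * card ?Vb \<le> CARD('a) ^ u * card ?Vd" by (simp add: card_polys_below)
  have "card (level_set A N d t) \<le> card H * d * CARD('a) ^ (N - t)"
    by (rule card_level_set_le[OF A t d finH]) (auto simp: H_def level_set_def)
  then have "card (level_set A N d t) * card ?Vb \<le> (card H * card ?Vb) * d * CARD('a) ^ u"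
    using mult_right_mono[of "card (level_set A N d t)" "card H * d * CARD('a) ^ u" "card ?Vb"] u(1)
    by (simp add: mult.commute mult.left_commute)
  also have "\<dots> \<le> CARD('a) ^ u * card ?Vd * d * CARD('a) ^ u"
    using cardH by (intro mult_right_mono) auto
  finally show ?thesis .
qed

section \<open>Summability\<close>

text \<open>At scale m, membership in the ideal means that Q(x, g) \<equiv> 0 mod x^m, so only the
  residue of g modulo x^m matters.\<close>

definition avoids_low_degree :: "real \<Rightarrow> nat \<Rightarrow> 'a::idom poly \<Rightarrow> bool" where
  "avoids_low_degree \<kappa> m g \<longleftrightarrow>
     (\<forall>Q. Q \<noteq> 0 \<and> real (total_degree Q) ^ 2 \<le> 2 * \<kappa> * real m \<longrightarrow> Q \<notin> weight_ideal m m g)"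

lemma nat_floor_sqrt:
  assumes "x \<ge> 0"
  shows "real (nat \<lfloor>sqrt x\<rfloor>) ^ 2 \<le> x" "x < (real (nat \<lfloor>sqrt x\<rfloor>) + 1) ^ 2"
proof -
  define b where "b = nat \<lfloor>sqrt x\<rfloor>"
  have b: "real b \<le> sqrt x" "sqrt x < real b + 1" using assms by (auto simp: b_def)
  have "real b ^ 2 \<le> sqrt x ^ 2" using b(1) by (intro power_mono) auto
  then show "real (nat \<lfloor>sqrt x\<rfloor>) ^ 2 \<le> x" using assms by (simp add: b_def)
  have "sqrt x ^ 2 < (real b + 1) ^ 2" using b(2) assms by (intro power_strict_mono) auto
  then show "x < (real (nat \<lfloor>sqrt x\<rfloor>) + 1) ^ 2" using assms by (simp add: b_def)
qed

lemma real_binomial_count: "real (Suc d * (d + 2) div 2) = (real d ^ 2 + 3 * real d + 2) / 2"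
proof -
  have "2 * (Suc d * (d + 2) div 2) = Suc d * (d + 2)" by simp
  then have "2 * real (Suc d * (d + 2) div 2) = real (Suc d * (d + 2))" by (metis of_nat_mult of_nat_numeral)
  also have "\<dots> = real d ^ 2 + 3 * real d + 2" by (simp add: algebra_simps power2_eq_square)
  finally show ?thesis by simp
qed

text \<open>The first exponent covers the cases \<open>4 * u \<le> d * d\<close>, by counting
  polynomials. The other two come from Bezout's bound, applied at (u, 2 u) if 2 t > N, for the
  second, and at (t, N) otherwise, for the third.\<close>

lemma card_level_set_real_bound:
  fixes A :: "'a::{field,finite} poly set" and \<kappa> \<kappa>' :: real
  defines "q \<equiv> real CARD('a)"
  assumes A: "A \<subseteq> polys_below N"
    and gen: "\<And>g m. g \<in> A \<Longrightarrow> n0 \<le> m \<Longrightarrow> m \<le> N \<Longrightarrow> avoids_low_degree \<kappa> m g"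
    and \<kappa>: "0 \<le> \<kappa>" "\<kappa> < 1" and \<kappa>': "0 < \<kappa>'" "\<kappa>' < 1"
    and d: "real d ^ 2 \<le> 2 * \<kappa>' * real N" "d < N" and t: "t \<le> N"
  shows "real (card (level_set A N d t)) \<le> real d *
     (q powr (\<kappa>' * (2 - \<kappa>) * real N + 3 / 2 * real d + 1 + 2 * real n0)
      + q powr ((1 + \<kappa>') * real N / 2 + 1)
      + q powr (real N - (1 - \<kappa>') * (real N / real d) + 1))"
    (is "_ \<le> _ * (q powr ?E1 + q powr ?E2 + q powr ?E3)")
proof (cases "level_set A N d t = {}")
  case False
  then obtain g where "g \<in> level_set A N d t" by blast
  then have Ntd: "N \<le> t * d" using d(2) by (rule level_set_nonempty_bound)
  have q: "q > 1" using card_field_ge_2[where 'a = 'a] by (simp add: q_def)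
  have qp: "real (CARD('a) ^ k) = q powr real k" for k
    using q by (simp add: q_def powr_realpow)
  have N: "N > 0" using d(2) by simp
  then have t0: "t > 0" and d0: "d > 0" using Ntd by (auto intro!: Nat.gr0I)
  define u where "u = N - t"
  have u: "real u = real N - real t" using t by (simp add: u_def of_nat_diff)
  have key: "real (card (level_set A N d t)) \<le> real d * (q powr ?E1 + q powr ?E2 + q powr ?E3)"
    if "real (card (level_set A N d t)) \<le> real d * q powr e" "e \<le> ?E1 \<or> e \<le> ?E2 \<or> e \<le> ?E3" for e
  proof -
    have "q powr e \<le> q powr ?E1 \<or> q powr e \<le> q powr ?E2 \<or> q powr e \<le> q powr ?E3"
      using that(2) q by (auto intro: powr_mono)
    then have "q powr e \<le> q powr ?E1 + q powr ?E2 + q powr ?E3"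
      using powr_ge_zero[of q ?E1] powr_ge_zero[of q ?E2] powr_ge_zero[of q ?E3] by linarith
    then show ?thesis using that(1) by (meson mult_left_mono of_nat_0_le_iff order_trans)
  qed
  define D where "D k = Suc k * (k + 2) div 2" for k
  have D: "real (D k) = (real k ^ 2 + 3 * real k + 2) / 2" for k
    unfolding D_def by (rule real_binomial_count)
  have \<kappa>'N: "\<kappa>' * real N \<le> \<kappa>' * (2 - \<kappa>) * real N" using \<kappa> \<kappa>' by (intro mult_right_mono) auto
  \<comment> \<open>Avoidance at m = 2 u is available only for 2 u \<ge> n0; for smaller u the
    trivial count loses no more than a bounded term in n0.\<close>
  consider (trivial) "4 * u \<le> d * d" "2 * u < n0" | (generic) "4 * u \<le> d * d" "n0 \<le> 2 * u"
    | (small_t) "d * d < 4 * u" "2 * t \<le> N" | (large_t) "d * d < 4 * u" "N < 2 * t" by linarith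
  then show ?thesis
  proof cases
    case trivial
    have "real (card (level_set A N d t)) \<le> real (CARD('a) ^ D d * d * CARD('a) ^ u)"
      using card_level_set_trivial[OF A t d(2)] unfolding card_bideg D_def u_def of_nat_le_iff .
    also have "\<dots> = real d * q powr (real (D d) + real u)" by (simp only: of_nat_mult qp powr_add mult_ac)
    finally show ?thesis
    proof (rule key)
      have "real (2 * u) \<le> real n0" using trivial(2) by (simp only: of_nat_le_iff)
      moreover have "real (D d) = real d ^ 2 / 2 + 3 / 2 * real d + 1" by (simp add: D field_simps)
      ultimately have "real (D d) + real u \<le> ?E1" using d(1) \<kappa>'N by simp
      then show "real (D d) + real u \<le> ?E1 \<or> real (D d) + real u \<le> ?E2 \<or> real (D d) + real u \<le> ?E3" by blast
    qed
  next
    case generic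
    \<comment> \<open>The largest degree that avoidance at m = 2 u excludes; its maximality yields
      \<open>D b \<ge> (b + 1)^2 / 2 > 2 \<kappa> u\<close>.\<close>
    define b where "b = nat \<lfloor>sqrt (4 * \<kappa> * real u)\<rfloor>"
    have b: "real b ^ 2 \<le> 4 * \<kappa> * real u" "4 * \<kappa> * real u < (real b + 1) ^ 2"
      using nat_floor_sqrt[of "4 * \<kappa> * real u"] \<kappa> by (simp_all add: b_def)
    have u4: "4 * real u \<le> real d ^ 2"
      using generic(1) by (metis of_nat_le_iff of_nat_mult of_nat_numeral power2_eq_square)
    have "real b ^ 2 \<le> real d ^ 2"
    proof -
      have "\<kappa> * (4 * real u) \<le> 1 * (4 * real u)" using \<kappa> by (intro mult_right_mono) auto
      then show ?thesis using b(1) u4 by linarith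
    qed
    then have bd: "b \<le> d" by (simp add: power2_le_iff_abs_le)
    have "2 * \<kappa>' * real N \<le> 2 * 1 * real N" using \<kappa>' by (intro mult_right_mono) auto
    then have "real (2 * u) \<le> real N" using u4 d(1) by simp
    then have uN: "2 * u \<le> N" by (simp only: of_nat_le_iff)
    have "Q \<notin> weight_ideal (2 * u) (2 * u) g" if "g \<in> A" "Q \<in> bideg b" "Q \<noteq> 0" for g Q
    proof -
      have "total_degree Q \<le> b" using that by (simp add: total_degree_le_iff)
      then have "real (total_degree Q) ^ 2 \<le> real b ^ 2" by (intro power_mono) auto
      also note b(1)
      also have "4 * \<kappa> * real u = 2 * \<kappa> * real (2 * u)" by simp
      finally have "real (total_degree Q) ^ 2 \<le> 2 * \<kappa> * real (2 * u)" .
      then show ?thesis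
        using gen[OF that(1) generic(2) uN] that(3) unfolding avoids_low_degree_def by blast
    qed
    from card_level_set_generic[OF A t d(2) bd u_def uN this]
    have "card (level_set A N d t) * CARD('a) ^ D b \<le> CARD('a) ^ u * CARD('a) ^ D d * d * CARD('a) ^ u"
      unfolding card_bideg D_def by simp
    then have "real (card (level_set A N d t) * CARD('a) ^ D b) \<le> real (CARD('a) ^ u * CARD('a) ^ D d * d * CARD('a) ^ u)"
      by (simp only: of_nat_le_iff)
    then have "real (card (level_set A N d t)) * q powr D b \<le> real d * q powr (2 * real u + real (D d))"
      by (simp only: of_nat_mult qp powr_add mult_2) (simp add: mult.commute mult.left_commute)
    also have "2 * real u + real (D d) = (2 * real u + real (D d) - real (D b)) + real (D b)" by simp
    finally have "real (card (level_set A N d t)) \<le> real d * q powr (2 * real u + real (D d) - real (D b))"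
      unfolding powr_add mult.assoc[symmetric] using q by (simp add: mult_le_cancel_right)
    then show ?thesis
    proof (rule key)
      have "2 * real u + real (D d) - real (D b) \<le> ?E1"
      proof -
        have "2 * real (D b) \<ge> (real b + 1) ^ 2" by (simp add: D power2_eq_square algebra_simps)
        then have "real (D b) \<ge> 2 * \<kappa> * real u" using b(2) by linarith
        then have 1: "2 * real u - real (D b) \<le> 2 * (1 - \<kappa>) * real u" by (simp add: algebra_simps)
        have "(1 - \<kappa>) * (4 * real u) \<le> (1 - \<kappa>) * real d ^ 2" using \<kappa> u4 by (intro mult_left_mono) auto
        moreover have "2 * (1 - \<kappa>) * real u = (1 - \<kappa>) * (4 * real u) / 2" by simp
        ultimately have 2: "2 * (1 - \<kappa>) * real u \<le> (1 - \<kappa>) * real d ^ 2 / 2" by linarith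
        have "(2 - \<kappa>) * real d ^ 2 \<le> (2 - \<kappa>) * (2 * \<kappa>' * real N)" using \<kappa> d(1) by (intro mult_left_mono) auto
        then have 3: "(1 - \<kappa>) * real d ^ 2 / 2 + real d ^ 2 / 2 \<le> \<kappa>' * (2 - \<kappa>) * real N"
          by (simp add: field_simps)
        have "real (D d) = real d ^ 2 / 2 + 3 / 2 * real d + 1" by (simp add: D field_simps)
        then show ?thesis using 1 2 3 by linarith
      qed
      then show "2 * real u + real (D d) - real (D b) \<le> ?E1 \<or> 2 * real u + real (D d) - real (D b) \<le> ?E2
        \<or> 2 * real u + real (D d) - real (D b) \<le> ?E3" by blast
    qed
  next
    case small_t
    have "real (d * d) < real (2 * N)"
    proof -
      have "\<kappa>' * real N < 1 * real N" using \<kappa>' N by (intro mult_strict_right_mono) auto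
      then show ?thesis using d(1) by (simp add: power2_eq_square)
    qed
    then have dN: "d * d < 2 * N" by (simp only: of_nat_less_iff)
    define s where "s = d * d * t div (2 * N) + 1"
    have "card (level_set A N d t) \<le> CARD('a) ^ s * d * CARD('a) ^ (N - t)"
      unfolding s_def by (rule card_level_set_bezout[OF A t d(2) t0 small_t(2) dN])
    then have "real (card (level_set A N d t)) \<le> real (CARD('a) ^ s * d * CARD('a) ^ u)"
      unfolding u_def by (simp only: of_nat_le_iff)
    also have "\<dots> = real d * q powr (real s + real u)" by (simp only: of_nat_mult qp powr_add mult_ac)
    finally show ?thesis
    proof (rule key)
      have "real (d * d * t div (2 * N)) \<le> real (d * d * t) / real (2 * N)" by (rule of_nat_div_le_of_nat)
      also have "\<dots> \<le> \<kappa>' * real t"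
      proof -
        have "real d ^ 2 * real t \<le> (2 * \<kappa>' * real N) * real t" using d(1) by (intro mult_right_mono) auto
        then show ?thesis using N by (simp add: field_simps power2_eq_square)
      qed
      finally have s: "real s \<le> \<kappa>' * real t + 1" by (simp add: s_def)
      \<comment> \<open>The cost is \<kappa>' t + 1 for h and N - t for the ball, a net saving of (1
        - \<kappa>') t up to the constant; here t \<ge> N / d enters.\<close>
      have "real N \<le> real t * real d" using Ntd by (metis of_nat_le_iff of_nat_mult)
      then have "real N / real d \<le> real t" using d0 by (simp add: field_simps)
      then have "(1 - \<kappa>') * (real N / real d) \<le> (1 - \<kappa>') * real t" using \<kappa>' by (intro mult_left_mono) auto
      then have "real s + real u \<le> ?E3" using s u by (simp add: algebra_simps)
      then show "real s + real u \<le> ?E1 \<or> real s + real u \<le> ?E2 \<or> real s + real u \<le> ?E3" by blast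
    qed
  next
    case large_t
    have u0: "u > 0" using large_t(1) by (auto intro!: Nat.gr0I)
    have uN: "2 * (N - t) \<le> N" using large_t(2) by linarith
    have W: "h \<in> weight_ideal u (2 * u) g" if "h \<in> weight_ideal t N g" for h and g :: "'a poly"
      unfolding u_def using that uN by (rule weight_ideal_double)
    define s where "s = d * d * u div (2 * (2 * u)) + 1"
    have "card (level_set A N d t) \<le> CARD('a) ^ s * d * CARD('a) ^ (N - t)"
      unfolding s_def by (rule card_level_set_bezout[OF A t d(2) u0 _ _ W]) (use large_t in auto)
    then have "real (card (level_set A N d t)) \<le> real (CARD('a) ^ s * d * CARD('a) ^ u)"
      unfolding u_def by (simp only: of_nat_le_iff)
    also have "\<dots> = real d * q powr (real s + real u)" by (simp only: of_nat_mult qp powr_add mult_ac)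
    finally show ?thesis
    proof (rule key)
      have "real (d * d * u div (2 * (2 * u))) \<le> real (d * d * u) / real (2 * (2 * u))" by (rule of_nat_div_le_of_nat)
      also have "\<dots> = real d ^ 2 / 4" using u0 by (simp add: field_simps power2_eq_square)
      finally have "real s \<le> real d ^ 2 / 4 + 1" by (simp add: s_def)
      moreover have "real u \<le> real N / 2" using large_t(2) u by simp
      ultimately have "real s + real u \<le> ?E2" using d(1) by (simp add: field_simps)
      then show "real s + real u \<le> ?E1 \<or> real s + real u \<le> ?E2 \<or> real s + real u \<le> ?E3" by blast
    qed
  qed
qed simp

text \<open>With n0 fixed this is a condition on a finite prefix, hence an event of the product
  space; all n0 are combined later.\<close>

definition bad_prefixes :: "real \<Rightarrow> real \<Rightarrow> nat \<Rightarrow> nat \<Rightarrow> 'a::idom poly set" where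
  "bad_prefixes \<kappa> \<kappa>' n0 N =
     {g \<in> polys_below N. (\<forall>m. n0 \<le> m \<and> m \<le> N \<longrightarrow> avoids_low_degree \<kappa> m g) \<and>
        (\<exists>h. irreducible h \<and> real (total_degree h) ^ 2 \<le> 2 * \<kappa>' * real N \<and> h \<in> weight_ideal N N g)}"

lemma card_bad_prefixes:
  fixes \<kappa> \<kappa>' :: real
  defines "q \<equiv> real CARD('a::{field,finite})"
  assumes \<kappa>: "0 \<le> \<kappa>" "\<kappa> < 1" and \<kappa>': "0 < \<kappa>'" "\<kappa>' < 1" and N: "N \<ge> 3"
  shows "real (card (bad_prefixes \<kappa> \<kappa>' n0 N :: 'a poly set)) / q ^ N \<le> (real N + 1) * (2 * real N) *
     (q powr (- (1 - \<kappa>' * (2 - \<kappa>)) * real N + 3 / 2 * sqrt (2 * real N) + 1 + 2 * real n0)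
      + q powr (- (1 - \<kappa>') / 2 * real N + 1)
      + q powr (- (1 - \<kappa>') * sqrt (real N / 2) + 1))"
proof -
  define A where "A = {g :: 'a poly. g \<in> polys_below N \<and> (\<forall>m. n0 \<le> m \<and> m \<le> N \<longrightarrow> avoids_low_degree \<kappa> m g)}"
  define d where "d = nat \<lfloor>sqrt (2 * \<kappa>' * real N)\<rfloor>"
  have q: "q > 1" using card_field_ge_2[where 'a = 'a] by (simp add: q_def)
  have d: "real d ^ 2 \<le> 2 * \<kappa>' * real N" "2 * \<kappa>' * real N < (real d + 1) ^ 2"
    using nat_floor_sqrt[of "2 * \<kappa>' * real N"] \<kappa>' by (simp_all add: d_def)
  have \<kappa>N: "2 * \<kappa>' * real N \<le> 2 * real N" using \<kappa>' by (simp add: mult_left_le_one_le)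
  have d2: "real d \<le> sqrt (2 * real N)" using d(1) \<kappa>N by (intro real_le_rsqrt) simp
  \<comment> \<open>From \<open>N \<ge> 3\<close> it follows that sqrt (2 N) < N, hence d < N as the
    counting bounds require.\<close>
  have "2 * real N < real N ^ 2" using N by (simp add: power2_eq_square)
  then have "sqrt (2 * real N) < real N" by (intro real_less_lsqrt) auto
  then have dN: "d < N" using d2 by linarith
  define e1 where "e1 = - (1 - \<kappa>' * (2 - \<kappa>)) * real N + 3 / 2 * sqrt (2 * real N) + 1 + 2 * real n0"
  define e2 where "e2 = - (1 - \<kappa>') / 2 * real N + 1"
  define e3 where "e3 = - (1 - \<kappa>') * sqrt (real N / 2) + 1"
  define S where "S = q powr e1 + q powr e2 + q powr e3"
  have S0: "S \<ge> 0" by (simp add: S_def)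
  have "bad_prefixes \<kappa> \<kappa>' n0 N \<subseteq> (\<Union>t\<le>N. level_set A N d t)"
  proof
    fix g :: "'a poly" assume g: "g \<in> bad_prefixes \<kappa> \<kappa>' n0 N"
    then obtain h where h: "irreducible h" "real (total_degree h) ^ 2 \<le> 2 * \<kappa>' * real N" "h \<in> weight_ideal N N g"
      by (auto simp: bad_prefixes_def)
    have "real (total_degree h) ^ 2 < (real d + 1) ^ 2" using h(2) d(2) by linarith
    then have "real (total_degree h) < real d + 1" by (rule power_less_imp_less_base) simp
    then have "total_degree h \<le> d" by simp
    moreover obtain t where "t \<le> N" "poly_cutoff t g \<in> minimal_balls N t h"
      using h(3) by (rule minimal_ball_exists)
    ultimately have "g \<in> level_set A N d t" using h(1) g by (auto simp: level_set_def A_def bad_prefixes_def)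
    with \<open>t \<le> N\<close> show "g \<in> (\<Union>t\<le>N. level_set A N d t)" by blast
  qed
  moreover have "finite (level_set A N d t)" for t
    by (rule finite_subset[OF _ finite_polys_below[of N]]) (auto simp: level_set_def A_def)
  ultimately have "card (bad_prefixes \<kappa> \<kappa>' n0 N :: 'a poly set) \<le> card (\<Union>t\<le>N. level_set A N d t)"
    by (intro card_mono) auto
  also have "\<dots> \<le> (\<Sum>t\<le>N. card (level_set A N d t))" by (rule card_UN_le) simp
  finally have "real (card (bad_prefixes \<kappa> \<kappa>' n0 N :: 'a poly set)) \<le> (\<Sum>t\<le>N. real (card (level_set A N d t)))"
    by (metis of_nat_le_iff of_nat_sum)
  also have "\<dots> \<le> (\<Sum>t\<le>N. 2 * real N * (q ^ N * S))"
  proof (rule sum_mono)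
    fix t assume "t \<in> {..N}"
    then have t: "t \<le> N" by simp
    have "real (card (level_set A N d t)) \<le> real d * (q ^ N * S)"
    proof (cases "d = 0")
      case True
      then have "level_set A N d t = {}" using level_set_nonempty_bound[OF _ dN] N by fastforce
      then show ?thesis using True by simp
    next
      case False
      have "(1 - \<kappa>') * sqrt (real N / 2) \<le> (1 - \<kappa>') * (real N / real d)"
      proof (intro mult_left_mono)
        have "sqrt (real N / 2) * real d \<le> sqrt (real N / 2) * sqrt (2 * real N)"
          using d2 by (intro mult_left_mono) auto
        also have "\<dots> = real N" by (simp flip: real_sqrt_mult)
        finally show "sqrt (real N / 2) \<le> real N / real d" using False by (simp add: field_simps)
      qed (use \<kappa>' in auto)
      then have le: "\<kappa>' * (2 - \<kappa>) * real N + 3 / 2 * real d + 1 + 2 * real n0 \<le> real N + e1"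
        "(1 + \<kappa>') * real N / 2 + 1 \<le> real N + e2"
        "real N - (1 - \<kappa>') * (real N / real d) + 1 \<le> real N + e3"
        using d2 by (simp_all add: e1_def e2_def e3_def field_simps)
      have "real (card (level_set A N d t)) \<le> real d *
         (q powr (\<kappa>' * (2 - \<kappa>) * real N + 3 / 2 * real d + 1 + 2 * real n0)
          + q powr ((1 + \<kappa>') * real N / 2 + 1)
          + q powr (real N - (1 - \<kappa>') * (real N / real d) + 1))"
        unfolding q_def by (rule card_level_set_real_bound[OF _ _ \<kappa> \<kappa>' d(1) dN t]) (auto simp: A_def)
      also have "\<dots> \<le> real d * (q powr (real N + e1) + q powr (real N + e2) + q powr (real N + e3))"
        by (intro mult_left_mono add_mono powr_mono le) (use q in auto)
      also have "\<dots> = real d * (q ^ N * S)"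
        using q by (simp add: S_def powr_add powr_realpow distrib_left)
      finally show ?thesis .
    qed
    also have "\<dots> \<le> 2 * real N * (q ^ N * S)" using dN S0 q by (intro mult_right_mono) auto
    finally show "real (card (level_set A N d t)) \<le> 2 * real N * (q ^ N * S)" .
  qed
  also have "\<dots> = ((real N + 1) * (2 * real N) * S) * q ^ N" by simp
  finally have "real (card (bad_prefixes \<kappa> \<kappa>' n0 N :: 'a poly set)) / q ^ N \<le> (real N + 1) * (2 * real N) * S"
    using q by (simp add: divide_le_eq)
  then show ?thesis by (simp only: S_def e1_def e2_def e3_def)
qed

text \<open>By \<open>\<kappa>' * (2 - \<kappa>) < 1\<close> the first exponent is linear with
  negative slope, up to a term of order sqrt N. The slowest decay is that of the third term,
  exponential in - sqrt N, which still beats the quadratic factor.\<close>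

lemma summable_bad_prefixes:
  fixes \<kappa> \<kappa>' :: real
  assumes \<kappa>: "0 \<le> \<kappa>" "\<kappa> < 1" and \<kappa>': "0 < \<kappa>'" "\<kappa>' < 1" "\<kappa>' * (2 - \<kappa>) < 1"
  shows "summable (\<lambda>N. real (card (bad_prefixes \<kappa> \<kappa>' n0 N :: 'a::{field,finite} poly set)) / real CARD('a) ^ N)"
proof -
  define q where "q = real CARD('a)"
  have q: "q > 1" using card_field_ge_2[where 'a = 'a] by (simp add: q_def)
  define a b :: real where "a = 1 - \<kappa>' * (2 - \<kappa>)" and "b = 1 - \<kappa>'"
  define c where "c = 1 + 2 * real n0"
  have ab: "a > 0" "b > 0" using \<kappa>' by (auto simp: a_def b_def)
  define f where "f N = (real N + 1) * (2 * real N) *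
     (q powr (- a * real N + 3 / 2 * sqrt (2 * real N) + 1 + 2 * real n0)
      + q powr (- b / 2 * real N + 1) + q powr (- b * sqrt (real N / 2) + 1))" for N
  define L where "L = ln q"
  have L: "L > 0" using q by (simp add: L_def)
  have f: "f = (\<lambda>N. (real N + 1) * (2 * real N) * exp (L * (c + 3 / 2 * sqrt (2 * real N) - a * real N))
      + (real N + 1) * (2 * real N) * exp (L * (1 - b / 2 * real N))
      + (real N + 1) * (2 * real N) * exp (L * (1 - b * sqrt (real N / 2))))"
    using q by (simp add: f_def fun_eq_iff powr_def L_def c_def algebra_simps)
  have "(\<lambda>N. (real N + 1) * (2 * real N) * exp (L * (c + 3 / 2 * sqrt (2 * real N) - a * real N)))
      \<in> O(\<lambda>N. 1 / real N ^ 2)"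
    using L ab(1) by real_asymp
  moreover have "(\<lambda>N. (real N + 1) * (2 * real N) * exp (L * (1 - b / 2 * real N))) \<in> O(\<lambda>N. 1 / real N ^ 2)"
    using L ab(2) by real_asymp
  moreover have "(\<lambda>N. (real N + 1) * (2 * real N) * exp (L * (1 - b * sqrt (real N / 2)))) \<in> O(\<lambda>N. 1 / real N ^ 2)"
    using L ab(2) by real_asymp
  ultimately have "f \<in> O(\<lambda>N. 1 / real N ^ 2)"
    unfolding f by (intro sum_in_bigo)
  then have "summable f"
    by (rule summable_comparison_test_bigo[rotated])
      (use inverse_power_summable[of 2, where 'a = real] in \<open>simp add: inverse_eq_divide\<close>)
  moreover have "\<forall>\<^sub>F N in sequentially. norm (real (card (bad_prefixes \<kappa> \<kappa>' n0 N :: 'a poly set)) / q ^ N) \<le> f N"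
    using eventually_ge_at_top[of 3]
  proof eventually_elim
    case (elim N)
    show ?case using card_bad_prefixes[OF \<kappa> \<kappa>'(1,2) elim, where 'a = 'a and ?n0.0 = n0] q
      by (simp add: f_def q_def a_def b_def)
  qed
  ultimately show ?thesis unfolding q_def by (rule summable_comparison_test_ev[rotated])
qed

section \<open>Power series and the measure\<close>

lemma subst_y_0 [simp]: "subst_y 0 G = 0"
  by (simp add: subst_y_def)

lemma subst_y_pCons: "subst_y (pCons a p) G = fps_of_poly a + G * subst_y p G"
  by (simp add: subst_y_def Polynomial.map_poly_pCons)

lemma subst_y_1 [simp]: "subst_y 1 G = 1"
  using subst_y_pCons[of 1 0 G] by simp

lemma subst_y_add: "subst_y (p + q) G = subst_y p G + subst_y q G"
  by (induction p q rule: poly_induct2) (simp_all add: subst_y_pCons fps_of_poly_add algebra_simps)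

lemma subst_y_smult: "subst_y (smult a p) G = fps_of_poly a * subst_y p G"
  by (induction p) (simp_all add: subst_y_pCons fps_of_poly_mult algebra_simps)

lemma subst_y_mult: "subst_y (p * q) G = subst_y p G * subst_y q G"
  by (induction p) (simp_all add: subst_y_pCons subst_y_add subst_y_smult algebra_simps)

lemma subst_y_fps_of_poly: "subst_y h (fps_of_poly g) = fps_of_poly (poly h g)"
  by (induction h) (simp_all add: subst_y_pCons fps_of_poly_add fps_of_poly_mult)

lemma dvd_subst_y_diff: "G - G' dvd subst_y h G - subst_y h G'"
proof (induction h)
  case (pCons a p)
  have "subst_y (pCons a p) G - subst_y (pCons a p) G' =
      (G - G') * subst_y p G + G' * (subst_y p G - subst_y p G')"
    by (simp add: subst_y_pCons algebra_simps)
  then show ?case using pCons by (simp add: dvd_add)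
qed simp

lemma fps_X_power_dvd_iff: "fps_X ^ n dvd f \<longleftrightarrow> (\<forall>i<n. fps_nth f i = 0)" for f :: "'a::field fps"
proof
  assume "fps_X ^ n dvd f"
  then show "\<forall>i<n. fps_nth f i = 0" by (auto simp: fps_X_power_mult_nth)
next
  assume *: "\<forall>i<n. fps_nth f i = 0"
  show "fps_X ^ n dvd f"
  proof (cases "f = 0")
    case False
    then have "n \<le> subdegree f" using * by (intro subdegree_geI) auto
    then have "f = fps_X ^ n * fps_shift n f" by (metis fps_shift_times_fps_X_power mult.commute)
    then show ?thesis by (rule dvdI)
  qed simp
qed

definition prefix_poly :: "nat \<Rightarrow> (nat \<Rightarrow> 'a::zero) \<Rightarrow> 'a poly" where
  "prefix_poly N s = Abs_poly (\<lambda>i. if i < N then s i else 0)"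

lemma coeff_prefix_poly: "coeff (prefix_poly N s) i = (if i < N then s i else 0)"
proof -
  have "coeff (prefix_poly N s) = (\<lambda>i. if i < N then s i else 0)"
    unfolding prefix_poly_def by (rule coeff_Abs_poly[of N]) simp
  then show ?thesis by simp
qed

lemma prefix_poly_in_polys_below: "prefix_poly N s \<in> polys_below N"
  by (simp add: polys_below_def coeff_prefix_poly)

lemma poly_cutoff_prefix_poly: "m \<le> N \<Longrightarrow> poly_cutoff m (prefix_poly N s) = prefix_poly m s"
  by (rule poly_eqI) (simp add: coeff_poly_cutoff coeff_prefix_poly)

lemma weight_ideal_prefix_poly:
  "m \<le> N \<Longrightarrow> weight_ideal m n (prefix_poly N s) = weight_ideal m n (prefix_poly m s)"
  by (metis order_refl poly_cutoff_prefix_poly weight_ideal_cutoff)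

text \<open>G and its prefix agree modulo x^n, and h(x, G) - h(x, G') is a multiple of G -
  G'.\<close>

lemma dvd_subst_y_iff_weight_ideal:
  "fps_X ^ n dvd subst_y h (Abs_fps s) \<longleftrightarrow> h \<in> weight_ideal n n (prefix_poly n s)"
  for s :: "nat \<Rightarrow> 'a::field"
proof -
  have "fps_X ^ n dvd Abs_fps s - fps_of_poly (prefix_poly n s)"
    by (simp add: fps_X_power_dvd_iff coeff_prefix_poly)
  then have "fps_X ^ n dvd subst_y h (Abs_fps s) - subst_y h (fps_of_poly (prefix_poly n s))"
    using dvd_subst_y_diff by (rule dvd_trans)
  then have "fps_X ^ n dvd subst_y h (Abs_fps s) \<longleftrightarrow> fps_X ^ n dvd subst_y h (fps_of_poly (prefix_poly n s))"
    by (metis diff_add_cancel dvd_add_right_iff)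
  also have "\<dots> \<longleftrightarrow> monom 1 n dvd poly h (prefix_poly n s)"
    by (simp add: subst_y_fps_of_poly fps_X_power_dvd_iff monom_1_dvd_iff')
  finally show ?thesis by (simp add: weight_ideal_full_scale_iff)
qed

section \<open>Passage to irreducible factors\<close>

lemma fps_X_power_dvd_mult_split:
  fixes f g :: "'a::field fps"
  assumes "fps_X ^ m dvd f * g"
  obtains m1 m2 where "m1 + m2 = m" "fps_X ^ m1 dvd f" "fps_X ^ m2 dvd g"
proof -
  consider "f = 0" | "g = 0" | "f \<noteq> 0" "g \<noteq> 0" by blast
  then show thesis
  proof cases
    case 1 then show thesis using that[of m 0] by simp
  next
    case 2 then show thesis using that[of 0 m] by simp
  next
    case 3
    have "m \<le> subdegree (f * g)"
      using assms 3 unfolding fps_X_power_dvd_iff by (intro subdegree_geI) auto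
    then have m: "m \<le> subdegree f + subdegree g" using 3 by simp
    define m1 where "m1 = min m (subdegree f)"
    have "fps_X ^ m1 dvd f" unfolding fps_X_power_dvd_iff m1_def by (auto intro: nth_less_subdegree_zero)
    moreover have "fps_X ^ (m - m1) dvd g"
      using m unfolding fps_X_power_dvd_iff m1_def by (auto intro: nth_less_subdegree_zero)
    ultimately show thesis using that[of m1 "m - m1"] by (simp add: m1_def)
  qed
qed

lemma total_degree_pos_iff:
  fixes Q :: "'a::field poly poly"
  assumes "Q \<noteq> 0"
  shows "total_degree Q > 0 \<longleftrightarrow> \<not> is_unit Q"
proof
  assume pos: "total_degree Q > 0"
  show "\<not> is_unit Q"
  proof
    assume "is_unit Q"
    then obtain R where R: "Q * R = 1" by (metis dvdE)
    then have "R \<noteq> 0" by auto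
    then have "total_degree Q \<le> total_degree (1 :: 'a poly poly)"
      using total_degree_mult[OF assms] R by fastforce
    moreover have "total_degree (1 :: 'a poly poly) \<le> 0"
      unfolding total_degree_le_iff bideg_iff by (auto simp: coeff_pCons split: if_splits nat.splits)
    ultimately show False using pos by simp
  qed
next
  assume nu: "\<not> is_unit Q"
  show "total_degree Q > 0"
  proof (rule ccontr)
    assume "\<not> total_degree Q > 0"
    then have "Q \<in> bideg 0" by (simp flip: total_degree_le_iff)
    then have Q: "coeff (coeff Q i) j = 0" if "i + j > 0" for i j
      using that unfolding bideg_iff by (metis le_zero_eq less_numeral_extra(3))
    define c where "c = coeff (coeff Q 0) 0"
    have Qc: "Q = [:[:c:]:]"
      using Q by (auto simp: poly_eq_iff coeff_pCons c_def split: nat.splits)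
    then have "c \<noteq> 0" using assms by auto
    then show False using nu unfolding Qc by (simp add: is_unit_const_poly_iff dvd_field_iff)
  qed
qed

text \<open>When Q = a b, the order of vanishing and the degree both split as sums, so one factor
  has a ratio of order to degree at least that of Q. Induction on the degree ends at an irreducible
  factor.\<close>

lemma irreducible_factor_good_ratio:
  fixes Q :: "'a::field poly poly"
  assumes "Q \<noteq> 0" "total_degree Q > 0" "fps_X ^ m dvd subst_y Q G"
  shows "\<exists>h m'. irreducible h \<and> total_degree h > 0 \<and> fps_X ^ m' dvd subst_y h G \<and> m' \<le> m \<and>
     m * total_degree h \<le> m' * total_degree Q"
  using assms
proof (induction "total_degree Q" arbitrary: Q m rule: less_induct)
  case less
  show ?case
  proof (cases "irreducible Q")
    case True
    then show ?thesis using less.prems by (intro exI[of _ Q] exI[of _ m]) auto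
  next
    case False
    have "\<not> is_unit Q" using less.prems total_degree_pos_iff by blast
    then obtain a b where ab: "Q = a * b" "\<not> is_unit a" "\<not> is_unit b"
      using False less.prems(1) unfolding irreducible_def by blast
    have nz: "a \<noteq> 0" "b \<noteq> 0" using ab(1) less.prems(1) by auto
    have pos: "total_degree a > 0" "total_degree b > 0" using ab nz total_degree_pos_iff by blast+
    have td: "total_degree Q = total_degree a + total_degree b"
      unfolding ab(1) by (rule total_degree_mult[OF nz])
    obtain m1 m2 where m: "m1 + m2 = m" "fps_X ^ m1 dvd subst_y a G" "fps_X ^ m2 dvd subst_y b G"
      using less.prems(3) unfolding ab(1) subst_y_mult by (rule fps_X_power_dvd_mult_split)
    have step: ?thesis if c: "c \<noteq> 0" "total_degree c > 0" "total_degree c < total_degree Q"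
      "fps_X ^ k dvd subst_y c G" "k \<le> m" "m * total_degree c \<le> k * total_degree Q" for c k
    proof -
      obtain h m' where h: "irreducible h" "total_degree h > 0" "fps_X ^ m' dvd subst_y h G" "m' \<le> k"
         "k * total_degree h \<le> m' * total_degree c"
        using less.hyps[OF c(3,1,2,4)] by blast
      have "(m * total_degree h) * total_degree c = (m * total_degree c) * total_degree h" by simp
      also have "\<dots> \<le> (k * total_degree Q) * total_degree h" using c(6) by (rule mult_right_mono) simp
      also have "\<dots> = (k * total_degree h) * total_degree Q" by simp
      also have "\<dots> \<le> (m' * total_degree c) * total_degree Q" using h(5) by (rule mult_right_mono) simp
      also have "\<dots> = (m' * total_degree Q) * total_degree c" by simp
      finally have "m * total_degree h \<le> m' * total_degree Q" using c(2) by simp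
      with h c(5) show ?thesis by (meson order_trans)
    qed
    have "m * total_degree a \<le> m1 * total_degree Q \<or> m * total_degree b \<le> m2 * total_degree Q"
    proof (rule ccontr)
      assume "\<not> ?thesis"
      then have "m1 * total_degree Q + m2 * total_degree Q < m * total_degree a + m * total_degree b" by simp
      also have "\<dots> = (m1 + m2) * total_degree Q" by (simp add: td m(1) distrib_left)
      finally show False by (simp add: distrib_right)
    qed
    then show ?thesis
    proof
      assume "m * total_degree a \<le> m1 * total_degree Q"
      then show ?thesis using nz pos td m by (intro step[of a m1]) auto
    next
      assume "m * total_degree b \<le> m2 * total_degree Q"
      then show ?thesis using nz pos td m by (intro step[of b m2]) auto
    qed
  qed
qed

definition eventually_avoids :: "real \<Rightarrow> (nat \<Rightarrow> 'a::field) \<Rightarrow> bool" where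
  "eventually_avoids \<kappa> s \<longleftrightarrow> (\<exists>n0. \<forall>m\<ge>n0. avoids_low_degree \<kappa> m (prefix_poly m s))"

lemma not_dvd_subst_y_const:
  fixes Q :: "'a::field poly poly"
  assumes "Q \<noteq> 0" "total_degree Q = 0" "m > 0"
  shows "\<not> fps_X ^ m dvd subst_y Q G"
proof
  assume *: "fps_X ^ m dvd subst_y Q G"
  have "is_unit Q" using assms(2) total_degree_pos_iff[OF assms(1)] by simp
  then obtain R where R: "1 = Q * R" by (rule dvdE)
  have "subst_y Q G * subst_y R G = subst_y 1 G" by (simp only: R subst_y_mult)
  also have "\<dots> = 1" by simp
  finally have "fps_X ^ m dvd (1 :: 'a fps)" using * by (metis dvd_mult2)
  then show False using assms(3) by (auto simp: fps_X_power_dvd_iff)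
qed

text \<open>An irreducible factor h of Q satisfies \<open>m * deg h \<le> m' * deg Q\<close>.
  Squaring gives \<open>(deg h)^2 \<le> 2 \<kappa> m'^2 / m\<close>, and m' \<le> m makes this at
  most 2 \<kappa> m'.\<close>

lemma eventually_avoids_of_irreducible:
  fixes s :: "nat \<Rightarrow> 'a::field"
  assumes \<kappa>: "\<kappa> \<le> 1"
    and irr: "\<And>N h. N \<ge> n1 \<Longrightarrow> irreducible h \<Longrightarrow> real (total_degree h) ^ 2 \<le> 2 * \<kappa> * real N \<Longrightarrow>
       h \<notin> weight_ideal N N (prefix_poly N s)"
  shows "eventually_avoids \<kappa> s"
  unfolding eventually_avoids_def avoids_low_degree_def
\<comment> \<open>As h has degree at least 1 and \<kappa> \<le> 1, it follows that m \<le> 2 m'^2;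
  so m > 2 n1^2 forces m' \<ge> n1.\<close>
proof (intro exI[of _ "2 * n1 ^ 2 + 1"] allI impI)
  fix m and Q :: "'a poly poly"
  assume m: "2 * n1 ^ 2 + 1 \<le> m" and Q: "Q \<noteq> 0 \<and> real (total_degree Q) ^ 2 \<le> 2 * \<kappa> * real m"
  define G where "G = Abs_fps s"
  show "Q \<notin> weight_ideal m m (prefix_poly m s)"
  proof
    assume "Q \<in> weight_ideal m m (prefix_poly m s)"
    then have dvd: "fps_X ^ m dvd subst_y Q G" by (simp add: G_def dvd_subst_y_iff_weight_ideal)
    then have pos: "total_degree Q > 0" using not_dvd_subst_y_const[of Q m G] Q m by fastforce
    obtain h m' where h: "irreducible h" "total_degree h > 0" "fps_X ^ m' dvd subst_y h G" "m' \<le> m"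
       "m * total_degree h \<le> m' * total_degree Q"
      using irreducible_factor_good_ratio[of Q m G] Q pos dvd by blast
    have m0: "real m > 0" using m by simp
    have "real (m * total_degree h) \<le> real (m' * total_degree Q)" using h(5) by (simp only: of_nat_le_iff)
    then have "(real m * real (total_degree h)) ^ 2 \<le> (real m' * real (total_degree Q)) ^ 2"
      by (intro power_mono) auto
    also have "\<dots> \<le> real m' ^ 2 * (2 * \<kappa> * real m)"
      using Q by (simp add: power_mult_distrib mult_left_mono)
    finally have "real m * (real m * real (total_degree h) ^ 2) \<le> real m * (2 * \<kappa> * real m' ^ 2)"
      by (simp add: power_mult_distrib power2_eq_square mult.commute mult.left_commute)
    then have le: "real m * real (total_degree h) ^ 2 \<le> 2 * \<kappa> * real m' ^ 2" using m0 by simp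
    have "0 < real m * real (total_degree h) ^ 2" using m0 h(2) by simp
    then have "0 < 2 * \<kappa> * real m' ^ 2" using le by linarith
    then have \<kappa>0: "\<kappa> > 0" by (simp add: zero_less_mult_iff)
    have "m' \<ge> n1"
    proof (rule ccontr)
      assume "\<not> m' \<ge> n1"
      then have "real m' \<le> real n1" by simp
      then have "real m' ^ 2 \<le> real n1 ^ 2" by (rule power_mono) simp
      then have "2 * \<kappa> * real m' ^ 2 \<le> 2 * 1 * real n1 ^ 2" using \<kappa> \<kappa>0 by (intro mult_mono) auto
      moreover have "real m * 1 \<le> real m * real (total_degree h) ^ 2"
        using h(2) by (intro mult_left_mono) auto
      moreover have "real m \<ge> 2 * real n1 ^ 2 + 1"
      proof -
        have "real (2 * n1 ^ 2 + 1) \<le> real m" using m by (simp only: of_nat_le_iff)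
        then show ?thesis by simp
      qed
      ultimately show False using le by linarith
    qed
    moreover have "real (total_degree h) ^ 2 \<le> 2 * \<kappa> * real m'"
    proof -
      have "real m' * real m' \<le> real m' * real m" using h(4) by (intro mult_left_mono) auto
      then have "2 * \<kappa> * real m' ^ 2 \<le> 2 * \<kappa> * (real m' * real m)"
        unfolding power2_eq_square by (rule mult_left_mono) (use \<kappa>0 in simp)
      then have "real m * real (total_degree h) ^ 2 \<le> real m * (2 * \<kappa> * real m')"
        using le by (simp add: mult.commute mult.left_commute)
      then show ?thesis using m0 by simp
    qed
    ultimately have "h \<notin> weight_ideal m' m' (prefix_poly m' s)" using irr h(1) by blast
    then show False using h(3) by (simp add: G_def dvd_subst_y_iff_weight_ideal)
  qed
qed

section \<open>Borel-Cantelli and the iteration\<close>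

abbreviation iid_uniform :: "(nat \<Rightarrow> 'a::finite) measure" where
  "iid_uniform \<equiv> \<Pi>\<^sub>M i\<in>(UNIV :: nat set). uniform_count_measure (UNIV :: 'a set)"

text \<open>A fixed prefix is a cylinder over N independent uniform coordinates and has measure
  q^(-N); the event is a finite disjoint union of such cylinders.\<close>

lemma prefix_event:
  fixes S :: "'a::{field,finite} poly set"
  assumes S: "S \<subseteq> polys_below N"
  shows "{s. prefix_poly N s \<in> S} \<in> sets (iid_uniform :: (nat \<Rightarrow> 'a) measure)" (is ?A)
    and "measure iid_uniform {s. prefix_poly N s \<in> S} = real (card S) / real CARD('a) ^ N" (is ?B)
proof -
  interpret P: product_prob_space "\<lambda>i :: nat. uniform_count_measure (UNIV :: 'a set)" UNIV
    by (intro product_prob_spaceI prob_space_uniform_count_measure) auto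
  have sp: "space (iid_uniform :: (nat \<Rightarrow> 'a) measure) = UNIV"
    by (simp add: space_PiM space_uniform_count_measure)
  have eq: "{s. prefix_poly N s = g} = {s \<in> space iid_uniform. \<forall>i\<in>{..<N}. s i \<in> {coeff g i}}"
    if "g \<in> polys_below N" for g :: "'a poly"
    using that unfolding sp by (auto simp: poly_eq_iff coeff_prefix_poly polys_below_def)
  have sets1: "{s. prefix_poly N s = g} \<in> sets iid_uniform" if "g \<in> polys_below N" for g :: "'a poly"
    unfolding eq[OF that]
    by (intro sets.sets_Collect_finite_All sets_Collect_single') (auto simp: sets_uniform_count_measure)
  have meas1: "measure iid_uniform {s. prefix_poly N s = g} = 1 / real CARD('a) ^ N"
    if "g \<in> polys_below N" for g :: "'a poly"
  proof -
    have "emeasure iid_uniform {s. prefix_poly N s = g} =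
        (\<Prod>i<N. emeasure (uniform_count_measure (UNIV :: 'a set)) {coeff g i})"
      unfolding eq[OF that] by (rule P.emeasure_PiM_Collect) (auto simp: sets_uniform_count_measure)
    also have "\<dots> = ennreal (1 / real CARD('a)) ^ N"
      by (simp add: emeasure_uniform_count_measure)
    also have "\<dots> = ennreal (1 / real CARD('a) ^ N)"
      by (simp add: ennreal_power power_one_over)
    finally show ?thesis by (simp add: measure_def)
  qed
  have fin: "finite S" using S finite_polys_below by (rule finite_subset)
  have U: "{s. prefix_poly N s \<in> S} = (\<Union>g\<in>S. {s. prefix_poly N s = g})" by auto
  show ?A unfolding U using fin S sets1 by (intro sets.finite_UN) auto
  have "measure iid_uniform (\<Union>g\<in>S. {s. prefix_poly N s = g}) =
      (\<Sum>g\<in>S. measure iid_uniform {s. prefix_poly N s = g})"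
    using fin S sets1 by (intro P.finite_measure_finite_Union) (auto simp: disjoint_family_on_def)
  also have "\<dots> = (\<Sum>g\<in>S. 1 / real CARD('a) ^ N)" using S meas1 by (intro sum.cong) auto
  finally show ?B unfolding U by simp
qed

lemma avoids_low_degree_prefix_poly:
  "m \<le> N \<Longrightarrow> avoids_low_degree \<kappa> m (prefix_poly N s) \<longleftrightarrow> avoids_low_degree \<kappa> m (prefix_poly m s)"
  unfolding avoids_low_degree_def by (simp add: weight_ideal_prefix_poly[of m N])

text \<open>The threshold n0 in the hypothesis depends on the sequence. Borel-Cantelli is therefore
  applied for each fixed n0, and the countably many exceptional null sets are united.\<close>

lemma AE_eventually_avoids_step:
  fixes \<kappa> \<kappa>' :: real
  assumes \<kappa>: "0 \<le> \<kappa>" "\<kappa> < 1" and \<kappa>': "0 < \<kappa>'" "\<kappa>' < 1" "\<kappa>' * (2 - \<kappa>) < 1"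
    and AE: "AE s in (iid_uniform :: (nat \<Rightarrow> 'a::{field,finite}) measure). eventually_avoids \<kappa> s"
  shows "AE s in (iid_uniform :: (nat \<Rightarrow> 'a) measure). eventually_avoids \<kappa>' s"
proof -
  let ?M = "iid_uniform :: (nat \<Rightarrow> 'a) measure"
  interpret P: product_prob_space "\<lambda>i :: nat. uniform_count_measure (UNIV :: 'a set)" UNIV
    by (intro product_prob_spaceI prob_space_uniform_count_measure) auto
  have "AE s in ?M. \<forall>\<^sub>F N in sequentially. prefix_poly N s \<notin> bad_prefixes \<kappa> \<kappa>' n0 N" for n0
  proof -
    have sub: "bad_prefixes \<kappa> \<kappa>' n0 N \<subseteq> (polys_below N :: 'a poly set)" for N
      by (auto simp: bad_prefixes_def)
    have "AE s in ?M. \<forall>\<^sub>F N in sequentially. s \<in> space ?M - {s. prefix_poly N s \<in> bad_prefixes \<kappa> \<kappa>' n0 N}"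
    proof (rule borel_cantelli_AE1)
      show "{s. prefix_poly N s \<in> bad_prefixes \<kappa> \<kappa>' n0 N} \<in> sets ?M" for N
        by (rule prefix_event(1)[OF sub])
      show "emeasure ?M {s. prefix_poly N s \<in> bad_prefixes \<kappa> \<kappa>' n0 N} < \<infinity>" for N
        by (simp add: P.emeasure_eq_measure)
      show "summable (\<lambda>N. measure ?M {s. prefix_poly N s \<in> bad_prefixes \<kappa> \<kappa>' n0 N})"
        unfolding prefix_event(2)[OF sub] using \<kappa> \<kappa>' by (rule summable_bad_prefixes)
    qed
    then show ?thesis by eventually_elim (auto elim: eventually_mono)
  qed
  then have "AE s in ?M. \<forall>n0. \<forall>\<^sub>F N in sequentially. prefix_poly N s \<notin> bad_prefixes \<kappa> \<kappa>' n0 N"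
    by (simp add: AE_all_countable)
  with AE show ?thesis
  proof eventually_elim
    case (elim s)
    then obtain n0 where n0: "\<And>m. m \<ge> n0 \<Longrightarrow> avoids_low_degree \<kappa> m (prefix_poly m s)"
      by (auto simp: eventually_avoids_def)
    obtain n1 where n1: "\<And>N. N \<ge> n1 \<Longrightarrow> prefix_poly N s \<notin> bad_prefixes \<kappa> \<kappa>' n0 N"
      using elim(2) unfolding eventually_sequentially by blast
    show ?case
    proof (rule eventually_avoids_of_irreducible[where ?n1.0 = n1])
      fix N and h :: "'a poly poly"
      assume h: "N \<ge> n1" "irreducible h" "real (total_degree h) ^ 2 \<le> 2 * \<kappa>' * real N"
      have "\<forall>m. n0 \<le> m \<and> m \<le> N \<longrightarrow> avoids_low_degree \<kappa> m (prefix_poly N s)"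
        using n0 by (simp add: avoids_low_degree_prefix_poly[of _ N])
      then show "h \<notin> weight_ideal N N (prefix_poly N s)"
        using n1[OF h(1)] h(2,3) unfolding bad_prefixes_def by (auto simp: prefix_poly_in_polys_below)
    qed (use \<kappa>' in simp)
  qed
qed

text \<open>For \<kappa> = 0 only nonzero constants compete, and these remain units after
  substitution. This starts the iteration.\<close>

lemma eventually_avoids_0: "eventually_avoids 0 s" for s :: "nat \<Rightarrow> 'a::field"
  unfolding eventually_avoids_def avoids_low_degree_def
proof (intro exI[of _ 1] allI impI)
  fix m and Q :: "'a poly poly"
  assume "1 \<le> m" "Q \<noteq> 0 \<and> real (total_degree Q) ^ 2 \<le> 2 * 0 * real m"
  then have "\<not> fps_X ^ m dvd subst_y Q (Abs_fps s)" by (intro not_dvd_subst_y_const) auto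
  then show "Q \<notin> weight_ideal m m (prefix_poly m s)" by (simp add: dvd_subst_y_iff_weight_ideal)
qed

text \<open>The admissible improvement \<open>\<kappa>' < 1 / (2 - \<kappa>)\<close> maps \<open>n / (n + 1)\<close> to \<open>(n + 1) / (n + 2)\<close>.\<close>

lemma AE_eventually_avoids:
  assumes \<theta>: "0 < \<theta>" "\<theta> < 1"
  shows "AE s in (iid_uniform :: (nat \<Rightarrow> 'a::{field,finite}) measure).
     eventually_avoids (\<theta> * real n / (real n + 1)) s"
proof (induction n)
  case 0
  show ?case by (simp add: eventually_avoids_0)
next
  case (Suc n)
  define \<kappa> \<kappa>' where "\<kappa> = \<theta> * real n / (real n + 1)" and "\<kappa>' = \<theta> * real (Suc n) / (real (Suc n) + 1)"
  have "\<theta> * real n \<le> 1 * real n" using \<theta> by (intro mult_right_mono) simp_all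
  then have \<kappa>: "0 \<le> \<kappa>" "\<kappa> < 1" "\<kappa>' < 1"
    using \<theta> by (simp_all add: \<kappa>_def \<kappa>'_def divide_less_eq distrib_left)
  have "0 < \<kappa>'" using \<theta> by (simp add: \<kappa>'_def)
  define a where "a = real n + 1"
  have a: "a > 0" "real n = a - 1" by (auto simp: a_def)
  have "2 - \<kappa> = (2 * real n + 2 - \<theta> * real n) / a"
    using a(1) by (simp add: \<kappa>_def a(2) field_simps)
  moreover have "\<kappa>' = \<theta> * a / (real n + 2)" by (simp add: \<kappa>'_def a_def add.commute)
  ultimately have "\<kappa>' * (2 - \<kappa>) = \<theta> * (2 * real n + 2 - \<theta> * real n) / (real n + 2)"
    using a(1) by simp
  also have "\<dots> < 1"
  proof -
    \<comment> \<open>This product equals the difference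
      \<open>real n + 2 - \<theta> * (2 * real n + 2 - \<theta> * real n)\<close>.\<close>
    have "(1 - \<theta>) * (real n * (1 - \<theta>) + 2) > 0" using \<theta> by (intro mult_pos_pos add_nonneg_pos) auto
    then have "\<theta> * (2 * real n + 2 - \<theta> * real n) < real n + 2" by (simp add: algebra_simps)
    then show ?thesis by (simp add: divide_less_eq)
  qed
  finally have "AE s in (iid_uniform :: (nat \<Rightarrow> 'a) measure). eventually_avoids \<kappa>' s"
    using \<kappa> \<open>0 < \<kappa>'\<close> Suc unfolding \<kappa>_def[symmetric] by (intro AE_eventually_avoids_step[of \<kappa> \<kappa>'])
  then show ?case by (simp add: \<kappa>'_def)
qed

section \<open>From avoidance to the expansion complexity\<close>

lemma irreducible_linear: "irreducible [:- g, 1:]" for g :: "'a::field poly"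
proof (rule irreducibleI)
  show "\<not> is_unit [:- g, 1:]" by (auto simp: poly_dvd_1)
  fix a b assume ab: "[:- g, 1:] = a * b"
  \<comment> \<open>A factor free of y is a polynomial in x and need not be a unit in general; here
    it divides the leading coefficient 1.\<close>
  have const: "is_unit c" if ce: "[:- g, 1:] = c * e" and deg: "degree c = 0" for c e
  proof -
    obtain p where p: "c = [:p:]" using deg by (rule degree_eq_zeroE)
    have "1 = coeff [:- g, 1:] 1" by simp
    also have "\<dots> = p * coeff e 1" unfolding ce p by simp
    finally have "is_unit p" by (rule dvdI)
    then show ?thesis by (simp add: p is_unit_const_poly_iff)
  qed
  have "a \<noteq> 0" "b \<noteq> 0" using ab by auto
  then have "degree a + degree b = degree [:- g, 1:]" unfolding ab by (rule degree_mult_eq[symmetric])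
  then have "degree a = 0 \<or> degree b = 0" by auto
  then show "is_unit a \<or> is_unit b" using const[of a b] const[of b a] ab by (auto simp: mult.commute)
qed simp

lemma i_expansion_complexity_lower_bound:
  fixes s :: "nat \<Rightarrow> 'a::field"
  assumes s: "eventually_avoids \<kappa> s" and \<kappa>: "\<kappa> > 0"
  shows "\<forall>\<^sub>F N in sequentially. sqrt \<kappa> \<le> real (i_expansion_complexity N s) / sqrt (2 * real N)"
proof -
  obtain n0 where n0: "\<And>m. m \<ge> n0 \<Longrightarrow> avoids_low_degree \<kappa> m (prefix_poly m s)"
    using s by (auto simp: eventually_avoids_def)
  have avoid: "2 * \<kappa> * real m < real (total_degree Q) ^ 2"
    if "m \<ge> n0" "Q \<noteq> 0" "fps_X ^ m dvd subst_y Q (Abs_fps s)" for m Q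
    using n0[OF that(1)] that(2,3) unfolding avoids_low_degree_def dvd_subst_y_iff_weight_ideal
    by (meson not_le)
  have "\<forall>\<^sub>F N in sequentially. N \<ge> n0 \<and> N > 0 \<and> real N \<ge> 1 / (2 * \<kappa>)"
    by (intro eventually_conj eventually_ge_at_top eventually_gt_at_top
        eventually_compose_filterlim[OF eventually_ge_at_top filterlim_real_sequentially])
  then show ?thesis
  proof eventually_elim
    case (elim N)
    let ?P = "\<lambda>d. \<exists>h :: 'a poly poly. irreducible h \<and> fps_X ^ N dvd subst_y h (Abs_fps s) \<and> total_degree h = d"
    \<comment> \<open>Otherwise the complexity would be 0 by definition. But then y itself, of
      degree at most 1, would annihilate the prefix, which avoidance forbids once 2 \<kappa> N \<ge>
      1.\<close>
    have "\<not> (\<forall>i<N. s i = 0)"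
    proof
      assume "\<forall>i<N. s i = 0"
      then have "fps_X ^ N dvd subst_y [:0, 1:] (Abs_fps s)"
        by (simp add: fps_X_power_dvd_iff subst_y_pCons)
      then have "2 * \<kappa> * real N < real (total_degree ([:0, 1:] :: 'a poly poly)) ^ 2"
        using elim by (intro avoid) auto
      also have "\<dots> \<le> 1 ^ 2"
      proof (intro power_mono)
        have "total_degree ([:0, 1:] :: 'a poly poly) \<le> 1"
          unfolding total_degree_le_iff bideg_iff by (auto simp: coeff_pCons split: nat.splits if_splits)
        then show "real (total_degree ([:0, 1:] :: 'a poly poly)) \<le> 1" by simp
      qed simp
      finally show False using elim \<kappa> by (simp add: field_simps)
    qed
    then have E: "i_expansion_complexity N s = (LEAST d. ?P d)"
      unfolding i_expansion_complexity_def by (rule if_not_P)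
    have "fps_X ^ N dvd subst_y [:- prefix_poly N s, 1:] (Abs_fps s)"
      by (simp add: fps_X_power_dvd_iff subst_y_pCons coeff_prefix_poly)
    then have "?P (total_degree [:- prefix_poly N s, 1:])" using irreducible_linear by blast
    then have "?P (LEAST d. ?P d)" by (rule LeastI)
    then obtain h :: "'a poly poly" where h: "irreducible h" "fps_X ^ N dvd subst_y h (Abs_fps s)"
      "total_degree h = i_expansion_complexity N s" unfolding E by blast
    have "2 * \<kappa> * real N < real (i_expansion_complexity N s) ^ 2"
      using avoid[of N h] h elim by auto
    then have "sqrt (2 * \<kappa> * real N) \<le> real (i_expansion_complexity N s)"
      by (intro real_le_lsqrt) auto
    then have "sqrt \<kappa> * sqrt (2 * real N) \<le> real (i_expansion_complexity N s)"
      by (simp add: mult.commute mult.left_commute flip: real_sqrt_mult)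
    then show ?case using elim by (simp add: le_divide_eq)
  qed
qed

theorem theorem2:
  "AE s in (sequence_measure :: (nat \<Rightarrow> 'a::{field,finite}) measure).
     liminf (\<lambda>N. ereal (real (i_expansion_complexity N s) / sqrt (2 * real N))) \<ge> 1"
proof -
  \<comment> \<open>The value reached after j iterations with \<theta> = 1 - 1 / (j + 2). Since
    these countably many values tend to 1, almost every sequence satisfies all the bounds at
    once.\<close>
  define \<rho> where "\<rho> j = (1 - 1 / (real j + 2)) * real j / (real j + 1)" for j :: nat
  have \<rho>: "(\<lambda>j. ereal (sqrt (\<rho> j))) \<longlonglongrightarrow> ereal 1"
  proof -
    have "\<rho> \<longlonglongrightarrow> 1" unfolding \<rho>_def by real_asymp
    then have "(\<lambda>j. sqrt (\<rho> j)) \<longlonglongrightarrow> sqrt 1" by (rule tendsto_real_sqrt)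
    then show ?thesis by simp
  qed
  have "AE s in (iid_uniform :: (nat \<Rightarrow> 'a) measure). eventually_avoids (\<rho> j) s" for j
    unfolding \<rho>_def by (rule AE_eventually_avoids) (auto simp: divide_less_eq)
  then have "AE s in (iid_uniform :: (nat \<Rightarrow> 'a) measure). \<forall>j. eventually_avoids (\<rho> j) s"
    by (simp add: AE_all_countable)
  then have "AE s in (iid_uniform :: (nat \<Rightarrow> 'a) measure).
     liminf (\<lambda>N. ereal (real (i_expansion_complexity N s) / sqrt (2 * real N))) \<ge> 1"
  proof eventually_elim
    case (elim s)
    \<comment> \<open>For j = 0 the value is 0, whereas the lower bound asks for a positive
      \<kappa>; the limit ignores this term.\<close>
    have "ereal (sqrt (\<rho> j)) \<le> liminf (\<lambda>N. ereal (real (i_expansion_complexity N s) / sqrt (2 * real N)))"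
      if "j \<ge> 1" for j
    proof (rule Liminf_bounded)
      have "0 < 1 - 1 / (real j + 2)" by (simp add: divide_less_eq)
      then have "\<rho> j > 0" using that by (simp add: \<rho>_def)
      from i_expansion_complexity_lower_bound[OF elim[rule_format] this]
      show "\<forall>\<^sub>F N in sequentially. ereal (sqrt (\<rho> j)) \<le> ereal (real (i_expansion_complexity N s) / sqrt (2 * real N))"
        by simp
    qed
    then have "ereal 1 \<le> liminf (\<lambda>N. ereal (real (i_expansion_complexity N s) / sqrt (2 * real N)))"
      by (intro LIMSEQ_le_const2[OF \<rho>]) blast
    then show ?case by (simp add: one_ereal_def)
  qed
  then show ?thesis unfolding sequence_measure_def by (rule AE_completion)
qed

end
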